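(* Let $\lambda\in(0,1/2)$ and $1<p<q<\infty$. Then the optimal hypercontractivity constant of the $\lambda$-biased Bernoulli random variable satisfies $$ \sigma_{p,q}(\lambda)=\frac{(1-y)\left(x+\frac{\lambda}{1-\lambda}\right)}{(1-x)\left(y+\frac{\lambda}{1-\lambda}\right)} $$ for some $(x,y)\in(0,1)^2$ that is a solution of the system $$ \left\{ \begin{aligned} &\frac{\big(\lambda+(1-\lambda)x^p\big)^{1/p}}{\lambda+(1-\lambda)x}=\frac{\big(\lambda+(1-\lambda)y^q\big)^{1/q}}{\lambda+(1-\lambda)y},\\ &\frac{(1-x)(1-x^{p-1})}{\lambda+(1-\lambda)x^p}=\frac{(1-y)(1-y^{q-1})}{\lambda+(1-\lambda)y^q}. \end{aligned} \right. $$ In the particular case $q=p^*:=p/(p-1)$ (so $1<p<2$), one has $$ \sigma_{p,p^*}(\lambda)=\frac{\sinh\left(\frac{1}{p^*}\log\frac{1-\lambda}{\lambda}\right)}{\sinh\left(\frac1p\log\frac{1-\lambda}{\lambda}\right)}. $$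
   Context: For $\lambda\in(0,1/2]$, the $\lambda$-biased Bernoulli random variable $X_\lambda$ is defined by $\mathbb{P}(X_\lambda=1-\lambda)=\lambda$ and $\mathbb{P}(X_\lambda=-\lambda)=1-\lambda$. For $1<p<q<\infty$ and $0\le r<1$, a real-valued random variable $X\in L^q$ is $(p,q,r)$-hypercontractive if $\|1+r\rho X\|_q\le\|1+\rho X\|_p$ for all $\rho\in\mathbb{R}$. The largest $r$ for which $X$ is $(p,q,r)$-hypercontractive is denoted $\sigma_{p,q}(X)$, and $\sigma_{p,q}(\lambda):=\sigma_{p,q}(X_\lambda)$. *)

theory Defs
  imports "HOL-Probability.Probability"
begin

definition Lp_norm :: "'a measure \<Rightarrow> real \<Rightarrow> ('a \<Rightarrow> real) \<Rightarrow> real" where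
  "Lp_norm M p f = (LINT \<omega>|M. \<bar>f \<omega>\<bar> powr p) powr (1 / p)"

text \<open>
  The clause on integrability says that X lies in \<open>L\<^sup>q\<close>; on a probability space it makes both norms
  below finite, so that the default value 0 of the integral never enters.
\<close>
definition hypercontractive ::
  "'a measure \<Rightarrow> ('a \<Rightarrow> real) \<Rightarrow> real \<Rightarrow> real \<Rightarrow> real \<Rightarrow> bool" where
  "hypercontractive M X p q r \<longleftrightarrow>
     prob_space M \<and> X \<in> borel_measurable M \<and> integrable M (\<lambda>\<omega>. \<bar>X \<omega>\<bar> powr q) \<and>
     1 < p \<and> p < q \<and> 0 \<le> r \<and> r < 1 \<and>
     (\<forall>\<rho>::real. Lp_norm M q (\<lambda>\<omega>. 1 + r * \<rho> * X \<omega>) \<le> Lp_norm M p (\<lambda>\<omega>. 1 + \<rho> * X \<omega>))"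

text \<open>
  \<open>Greatest\<close> rather than \<open>Sup\<close>: the constant is a maximum, and is unspecified when no largest
  admissible r exists.
\<close>
definition hc_const :: "'a measure \<Rightarrow> ('a \<Rightarrow> real) \<Rightarrow> real \<Rightarrow> real \<Rightarrow> real" where
  "hc_const M X p q = (GREATEST r. hypercontractive M X p q r)"

definition biased_bernoulli :: "real \<Rightarrow> bool \<Rightarrow> real" where
  "biased_bernoulli lam b = (if b then 1 - lam else - lam)"

lemma biased_bernoulli_law:
  assumes "0 < lam" "lam \<le> 1 / 2"
  shows "measure_pmf.prob (bernoulli_pmf lam) {b. biased_bernoulli lam b = 1 - lam} = lam"
    and "measure_pmf.prob (bernoulli_pmf lam) {b. biased_bernoulli lam b = - lam} = 1 - lam"
proof -
  have "{b. biased_bernoulli lam b = 1 - lam} = {True}"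
    "{b. biased_bernoulli lam b = - lam} = {False}"
    by (auto simp: biased_bernoulli_def split: if_splits)
  then show "measure_pmf.prob (bernoulli_pmf lam) {b. biased_bernoulli lam b = 1 - lam} = lam"
    and "measure_pmf.prob (bernoulli_pmf lam) {b. biased_bernoulli lam b = - lam} = 1 - lam"
    using assms by (simp_all add: measure_pmf_single)
qed

definition bernoulli_hc_const :: "real \<Rightarrow> real \<Rightarrow> real \<Rightarrow> real" where
  "bernoulli_hc_const p q lam =
     hc_const (measure_pmf (bernoulli_pmf lam)) (biased_bernoulli lam) p q"

end

theory Submission
  imports Defs "HOL-Real_Asymp.Real_Asymp"
begin

text \<open>
  Write \<open>\<phi>\<^sub>p(t)\<close> for the \<open>L\<^sup>p\<close> norm of \<open>1 + t X\<close>. Replacing \<open>1 + t X\<close> by its absolute value, only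
  the parameters \<open>t\<close> with \<open>1 + t X \<ge> 0\<close> matter. For negative such \<open>t\<close>, where the larger value is taken on
  the heavier atom, the two-point logarithmic Sobolev inequality holds with the constant of the
  symmetric case, and Gross's argument gives \<open>\<phi>\<^sub>q(R t) \<le> \<phi>\<^sub>p(t)\<close> with \<open>R\<^sup>2 = (p - 1) / (q - 1)\<close>.
  For small positive \<open>t\<close> the third-order term, governed by the skewness of \<open>X\<close>, violates this
  inequality. Hence the optimal constant \<open>s\<close> is smaller than \<open>R\<close> and, by compactness, equality
  \<open>\<phi>\<^sub>q(s t) = \<phi>\<^sub>p(t)\<close> occurs for some \<open>t > 0\<close>. The equality and the vanishing of the derivative
  there form the system; the vanishing of the derivative also excludes the boundary value of \<open>t\<close>.

  For conjugate exponents, Hoelder's inequality shows that the square of the \<open>(2, q)\<close> constant is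
  admissible for \<open>(p, q)\<close>. For \<open>(2, q)\<close> the unknown \<open>x\<close> can be eliminated from the system. With
  \<open>\<kappa> = \<lambda> / (1 - \<lambda>)\<close> and \<open>y\<close> fixed, what remains is an equation in \<open>\<kappa>\<close> whose only positive solution
  is \<open>\<kappa>\<^sup>2 = y\<^sup>q\<close>, by Rolle's theorem.
\<close>

subsection \<open>Norms of two-valued functions\<close>

text \<open>The point \<open>u = 0\<close> matters because an extremal parameter may a priori make
  \<open>1 - l * t\<close> vanish. There the difference quotient is bounded by
  \<open>\<bar>h\<bar> powr (p - 1)\<close>, which tends to 0 since \<open>p > 1\<close>.\<close>

lemma abs_powr_has_real_derivative:
  fixes u p :: real
  assumes "1 < p" "0 \<le> u"
  shows "((\<lambda>u. \<bar>u\<bar> powr p) has_real_derivative p * u powr (p - 1)) (at u)"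
proof (cases "u = 0")
  case False
  then have "0 < u" using assms by simp
  then have "((\<lambda>u. u powr p) has_real_derivative p * u powr (p - 1)) (at u)"
    by (rule has_real_derivative_powr)
  moreover have "\<forall>\<^sub>F v in nhds u. \<bar>v\<bar> powr p = v powr p"
    using eventually_nhds_in_open[of "{0<..}" u] \<open>0 < u\<close> by (auto elim!: eventually_mono)
  ultimately show ?thesis by (subst DERIV_cong_ev[OF refl _ refl]) auto
next
  case True
  have "((\<lambda>h::real. \<bar>h\<bar> powr (p - 1)) \<longlongrightarrow> 0) (at 0)"
    using tendsto_zero_powrI[of "\<lambda>h::real. \<bar>h\<bar>" "at 0" "\<lambda>_. p - 1" "p - 1"] assms
    by (auto simp: tendsto_rabs_zero_iff)
  then have "((\<lambda>h::real. (\<bar>h\<bar> powr p) / h) \<longlongrightarrow> 0) (at 0)"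
  proof (rule Lim_null_comparison[rotated])
    show "\<forall>\<^sub>F h in at 0. norm (\<bar>h\<bar> powr p / h) \<le> \<bar>h\<bar> powr (p - 1)"
    proof (rule eventually_at_filter[THEN iffD2], rule always_eventually, safe)
      fix h :: real
      assume "h \<noteq> 0"
      then show "norm (\<bar>h\<bar> powr p / h) \<le> \<bar>h\<bar> powr (p - 1)"
        by (simp add: powr_diff)
    qed
  qed
  then show ?thesis using True assms by (simp add: DERIV_def)
qed

text \<open>The \<open>p\<close>-th absolute moment of \<open>1 + t * X\<close> for \<open>X\<close>
  biased Bernoulli with parameter \<open>l\<close>. With \<open>l\<close> running over all of (0,1),
  a negative \<open>t\<close> becomes a positive one for the parameter \<open>1 - l\<close>.\<close>

definition mom :: "real \<Rightarrow> real \<Rightarrow> real \<Rightarrow> real" where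
  "mom l p t = l * \<bar>1 + (1 - l) * t\<bar> powr p + (1 - l) * \<bar>1 - l * t\<bar> powr p"

text \<open>The logarithm of the \<open>L^p\<close> norm of \<open>1 + t * X\<close>.\<close>

definition lognorm :: "real \<Rightarrow> real \<Rightarrow> real \<Rightarrow> real" where
  "lognorm l p t = ln (mom l p t) / p"

lemma mom_uminus: "mom l p (- t) = mom (1 - l) p t"
  by (simp add: mom_def)

lemma lognorm_uminus: "lognorm l p (- t) = lognorm (1 - l) p t"
  by (simp add: lognorm_def mom_uminus)

lemma mom_0 [simp]: "mom l p 0 = 1"
  by (simp add: mom_def)

lemma lognorm_0 [simp]: "lognorm l p 0 = 0"
  by (simp add: lognorm_def)

text \<open>The two values of \<open>1 + t * X\<close> have weighted mean 1, so they cannot both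
  vanish.\<close>

lemma mom_pos:
  assumes "0 < l" "l < 1"
  shows "0 < mom l p t"
proof -
  have "1 + (1 - l) * t \<noteq> 0 \<or> 1 - l * t \<noteq> 0"
    by (rule ccontr) (auto simp: left_diff_distrib)
  then have "0 < \<bar>1 + (1 - l) * t\<bar> powr p \<or> 0 < \<bar>1 - l * t\<bar> powr p" by simp
  then show ?thesis
    using assms unfolding mom_def
    by (elim disjE) (intro add_pos_nonneg add_nonneg_pos mult_pos_pos; simp)+
qed

lemma continuous_on_mom:
  assumes "0 < p"
  shows "continuous_on UNIV (mom l p)"
  unfolding mom_def[abs_def] using assms
  by (intro continuous_intros continuous_on_powr') auto

lemma continuous_on_lognorm:
  assumes "0 < l" "l < 1" "0 < p"
  shows "continuous_on S (lognorm l p)"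
proof -
  have "mom l p t \<noteq> 0" for t
    using mom_pos[OF assms(1,2), of p t] by simp
  then show ?thesis
    unfolding lognorm_def[abs_def]
    using continuous_on_subset[OF continuous_on_mom[OF assms(3), of l], of S] assms
    by (intro continuous_intros) auto
qed

lemma mom_has_real_derivative:
  assumes "0 < l" "l < 1" "1 < p" "0 \<le> t" "l * t \<le> 1"
  shows "(mom l p has_real_derivative
    p * (l * (1 - l) * ((1 + (1 - l) * t) powr (p - 1) - (1 - l * t) powr (p - 1)))) (at t)"
proof -
  have "0 \<le> 1 + (1 - l) * t" "0 \<le> 1 - l * t" using assms by simp_all
  note D = DERIV_chain2[where g = "\<lambda>t. 1 + (1 - l) * t", OF abs_powr_has_real_derivative[OF assms(3) this(1)]]
    DERIV_chain2[where g = "\<lambda>t. 1 - l * t", OF abs_powr_has_real_derivative[OF assms(3) this(2)]]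
  show ?thesis unfolding mom_def[abs_def]
    by (rule derivative_eq_intros D | simp)+ (simp add: algebra_simps)
qed

lemma lognorm_has_real_derivative:
  assumes "0 < l" "l < 1" "1 < p" "0 \<le> t" "l * t \<le> 1"
  shows "(lognorm l p has_real_derivative
    l * (1 - l) * ((1 + (1 - l) * t) powr (p - 1) - (1 - l * t) powr (p - 1)) / mom l p t) (at t)"
proof -
  define d where "d = l * (1 - l) * ((1 + (1 - l) * t) powr (p - 1) - (1 - l * t) powr (p - 1))"
  have "(mom l p has_real_derivative p * d) (at t)"
    unfolding d_def by (rule mom_has_real_derivative[OF assms])
  then have "(lognorm l p has_real_derivative d / mom l p t) (at t)"
    unfolding lognorm_def[abs_def] using assms mom_pos[of l p t]
    by (auto intro!: derivative_eq_intros)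
  then show ?thesis by (simp add: d_def)
qed

text \<open>The derivative has the sign of a difference of powers of two nonnegative values, the
  first of which exceeds the second by \<open>x\<close>.\<close>

lemma lognorm_strict_mono:
  assumes "0 < l" "l < 1" "1 < p" "0 \<le> s" "s < t" "l * t \<le> 1"
  shows "lognorm l p s < lognorm l p t"
proof (rule DERIV_pos_imp_increasing_open[OF assms(5)])
  show "continuous_on {s..t} (lognorm l p)"
    using assms by (intro continuous_on_lognorm) auto
  fix x assume x: "s < x" "x < t"
  have "l * x \<le> l * t" using x assms by simp
  then have lx: "l * x \<le> 1" using assms by linarith
  have "1 - l * x < 1 + (1 - l) * x" using x assms by (simp add: algebra_simps)
  then have "(1 - l * x) powr (p - 1) < (1 + (1 - l) * x) powr (p - 1)"
    using lx assms by (intro powr_less_mono2) auto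
  then have "0 < l * (1 - l) * ((1 + (1 - l) * x) powr (p - 1) - (1 - l * x) powr (p - 1)) / mom l p x"
    using assms mom_pos[of l p x] by (intro divide_pos_pos mult_pos_pos) auto
  moreover have "0 \<le> x" using x assms by simp
  ultimately show "\<exists>y. (lognorm l p has_real_derivative y) (at x) \<and> 0 < y"
    using lognorm_has_real_derivative[OF assms(1-3) _ lx] by blast
qed

lemma powr_lt_one:
  fixes y a :: real
  assumes "0 < y" "y < 1" "0 < a"
  shows "y powr a < 1"
  using powr_less_mono2[OF assms(3) less_imp_le[OF assms(1)] assms(2)] by simp

subsection \<open>The logarithmic Sobolev inequality on two points\<close>

text \<open>A two-point Stroock-Varopoulos inequality. It carries the logarithmic Sobolev inequality
  from squares to \<open>s\<close>-th powers.\<close>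

lemma powr_half_diff_sq_le:
  fixes a b s :: real
  assumes "0 < b" "b < a" "1 < s"
  shows "(a powr (s / 2) - b powr (s / 2))\<^sup>2
    \<le> s\<^sup>2 / (4 * (s - 1)) * (a - b) * (a powr (s - 1) - b powr (s - 1))"
proof -
  \<comment> \<open>Cauchy--Schwarz: \<open>F \<tau> x\<close> is the integral of \<open>(\<tau> - u powr (s/2 - 1))\<^sup>2\<close> over \<open>[b, x]\<close>.\<close>
  define F where "F \<tau> x = \<tau>\<^sup>2 * (x - b) - 2 * \<tau> * (2 / s) * (x powr (s / 2) - b powr (s / 2))
      + (x powr (s - 1) - b powr (s - 1)) / (s - 1)" for \<tau> x
  have F: "0 \<le> F \<tau> a" for \<tau>
  proof -
    have "F \<tau> b \<le> F \<tau> a"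
    proof (rule DERIV_nonneg_imp_nondecreasing[where f = "F \<tau>"])
      show "b \<le> a" using assms by simp
      fix x assume "b \<le> x" "x \<le> a"
      then have x: "0 < x" using assms by simp
      have sq: "x powr (s - 2) = (x powr (s / 2 - 1))\<^sup>2"
        by (simp add: power2_eq_square flip: powr_add)
      have "(F \<tau> has_real_derivative \<tau>\<^sup>2 - 2 * \<tau> * x powr (s / 2 - 1) + x powr (s - 2)) (at x)"
        unfolding F_def using assms x
        by (auto intro!: derivative_eq_intros simp: diff_diff_eq)
      moreover have "\<tau>\<^sup>2 - 2 * \<tau> * x powr (s / 2 - 1) + x powr (s - 2) = (\<tau> - x powr (s / 2 - 1))\<^sup>2"
        by (simp add: sq power2_diff)
      ultimately show "\<exists>y. (F \<tau> has_real_derivative y) (at x) \<and> 0 \<le> y"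
        by (metis zero_le_power2)
    qed
    then show ?thesis by (simp add: F_def)
  qed
  define d where "d = a powr (s / 2) - b powr (s / 2)"
  define e where "e = a powr (s - 1) - b powr (s - 1)"
  define w where "w = a - b"
  have "0 < w" using assms by (simp add: w_def)
  \<comment> \<open>The value \<open>2 / s * d / w\<close> is the mean of
    \<open>u powr (s / 2 - 1)\<close> over \<open>[b, a]\<close> and minimises the quadratic
    \<open>F \<tau> a\<close> in \<open>\<tau>\<close>.\<close>
  then have "(2 / s * d / w)\<^sup>2 * w - 2 * (2 / s * d / w) * (2 / s) * d = - (4 / s\<^sup>2 * d\<^sup>2 / w)"
    using assms by (simp add: field_simps power2_eq_square)
  moreover have "0 \<le> F (2 / s * d / w) a" by (rule F)
  ultimately have "4 / s\<^sup>2 * d\<^sup>2 / (a - b) \<le> e / (s - 1)"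
    by (simp add: F_def d_def[symmetric] e_def[symmetric] w_def[symmetric])
  then have "d\<^sup>2 \<le> s\<^sup>2 / (4 * (s - 1)) * (a - b) * e"
    using assms by (simp add: field_simps)
  then show ?thesis by (simp add: d_def e_def)
qed

text \<open>Equality holds at \<open>t = 1\<close>, and \<open>h\<close> has the derivative
  \<open>(1 - x)\<^sup>2 / (1 + x\<^sup>2)\<close>.\<close>

lemma ln_two_div_one_plus_sq_le:
  fixes t :: real
  assumes "0 < t" "t \<le> 1"
  shows "ln (2 / (1 + t\<^sup>2)) \<le> 1 - t"
proof -
  define h where "h t = ln (2 / (1 + t\<^sup>2)) - (1 - t)" for t :: real
  have "h t \<le> h 1"
  proof (rule DERIV_nonneg_imp_nondecreasing[OF assms(2)])
    fix x :: real
    have pos: "0 < 1 + x\<^sup>2" by (simp add: add_pos_nonneg)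
    have "h = (\<lambda>t. ln 2 - ln (1 + t\<^sup>2) - (1 - t))"
      by (rule ext) (smt (verit) h_def ln_div zero_le_power2)
    then have "(h has_real_derivative 1 - 2 * x / (1 + x\<^sup>2)) (at x)"
      using pos by (auto intro!: derivative_eq_intros)
    moreover have "0 \<le> 1 - 2 * x / (1 + x\<^sup>2)"
      using pos sum_squares_bound[of x 1] by (simp add: field_simps)
    ultimately show "\<exists>y. (h has_real_derivative y) (at x) \<and> 0 \<le> y" by blast
  qed
  then show ?thesis by (simp add: h_def)
qed

lemma DERIV_ln_square:
  fixes x :: real
  assumes "0 < x"
  shows "((\<lambda>x. ln (x\<^sup>2)) has_real_derivative 2 / x) (at x)"
  using assms by (auto intro!: derivative_eq_intros simp: power2_eq_square)

text \<open>For fixed \<open>b\<close> the defect \<open>h\<close> vanishes at \<open>x = b\<close>.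
  Its derivative is \<open>x - b\<close> minus \<open>x\<close> times a logarithm in the ratio
  \<open>b / x\<close>, which the preceding bound controls.\<close>

lemma log_sobolev_symmetric:
  fixes a b :: real
  assumes "0 < b" "b < a"
  shows "(a\<^sup>2 * ln (a\<^sup>2) + b\<^sup>2 * ln (b\<^sup>2)) / 2 - (a\<^sup>2 + b\<^sup>2) / 2 * ln ((a\<^sup>2 + b\<^sup>2) / 2)
    \<le> (a - b)\<^sup>2 / 2"
proof -
  define h where "h x = (x - b)\<^sup>2 / 2 - (x\<^sup>2 * ln (x\<^sup>2) + b\<^sup>2 * ln (b\<^sup>2)) / 2
    + (x\<^sup>2 + b\<^sup>2) / 2 * ln ((x\<^sup>2 + b\<^sup>2) / 2)" for x
  have "h b \<le> h a"
  proof (rule DERIV_nonneg_imp_nondecreasing[where f = h])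
    show "b \<le> a" using assms by simp
    fix x assume "b \<le> x" "x \<le> a"
    then have x: "0 < x" "b \<le> x" using assms by simp_all
    have m: "0 < x\<^sup>2 + b\<^sup>2" using x by (simp add: add_pos_nonneg)
    have "((\<lambda>x. ln ((x\<^sup>2 + b\<^sup>2) / 2)) has_real_derivative 2 * x / (x\<^sup>2 + b\<^sup>2)) (at x)"
      using m by (auto intro!: derivative_eq_intros)
    note D = this DERIV_ln_square[OF x(1)]
    have "(h has_real_derivative (x - b) - x * (ln (x\<^sup>2) - ln ((x\<^sup>2 + b\<^sup>2) / 2))) (at x)"
      unfolding h_def
      by (rule derivative_eq_intros D refl | simp)+
         (use x m in \<open>simp add: add_divide_distrib[symmetric] field_simps power2_eq_square\<close>)
    moreover have "ln (x\<^sup>2) - ln ((x\<^sup>2 + b\<^sup>2) / 2) = ln (2 / (1 + (b / x)\<^sup>2))"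
    proof -
      have "ln (x\<^sup>2) - ln ((x\<^sup>2 + b\<^sup>2) / 2) = ln (x\<^sup>2 / ((x\<^sup>2 + b\<^sup>2) / 2))"
        by (subst ln_div) (use x m in auto)
      also have "x\<^sup>2 / ((x\<^sup>2 + b\<^sup>2) / 2) = 2 / (1 + (b / x)\<^sup>2)"
        using x m by (simp add: field_simps)
      finally show ?thesis .
    qed
    moreover have "x * ln (2 / (1 + (b / x)\<^sup>2)) \<le> x * (1 - b / x)"
      using x assms by (intro mult_left_mono ln_two_div_one_plus_sq_le) auto
    moreover have "x * (1 - b / x) = x - b"
      using x by (simp add: right_diff_distrib)
    ultimately show "\<exists>y. (h has_real_derivative y) (at x) \<and> 0 \<le> y"
      by (metis diff_ge_0_iff_ge)
  qed
  moreover have "h b = 0" by (simp add: h_def)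
  ultimately have "0 \<le> h a" by simp
  then show ?thesis unfolding h_def by linarith
qed

text \<open>The right-hand side is twice the variance, the bound of the symmetric case; it survives
  because the larger value has the larger mass. The defect \<open>k\<close>, as a function of the
  mass at \<open>b\<close>, vanishes at 0 and 1, is nonnegative at 1/2 and has an increasing second
  derivative.\<close>

lemma log_sobolev_two_point:
  fixes a b \<theta> :: real
  assumes "0 < b" "b < a" "0 \<le> \<theta>" "\<theta> \<le> 1 / 2"
  shows "\<theta> * b\<^sup>2 * ln (b\<^sup>2) + (1 - \<theta>) * a\<^sup>2 * ln (a\<^sup>2)
      - (\<theta> * b\<^sup>2 + (1 - \<theta>) * a\<^sup>2) * ln (\<theta> * b\<^sup>2 + (1 - \<theta>) * a\<^sup>2)
    \<le> 2 * \<theta> * (1 - \<theta>) * (a - b)\<^sup>2"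
proof -
  define m where "m t = t * b\<^sup>2 + (1 - t) * a\<^sup>2" for t
  define k where "k t = 2 * t * (1 - t) * (a - b)\<^sup>2
    - t * b\<^sup>2 * ln (b\<^sup>2) - (1 - t) * a\<^sup>2 * ln (a\<^sup>2) + m t * ln (m t)" for t
  define k1 where "k1 t = 2 * (1 - 2 * t) * (a - b)\<^sup>2 - b\<^sup>2 * ln (b\<^sup>2) + a\<^sup>2 * ln (a\<^sup>2)
    - (a\<^sup>2 - b\<^sup>2) * (ln (m t) + 1)" for t
  define k2 where "k2 t = - 4 * (a - b)\<^sup>2 + (a\<^sup>2 - b\<^sup>2)\<^sup>2 / m t" for t
  have ab: "0 < b\<^sup>2" "b\<^sup>2 < a\<^sup>2" using assms by (auto intro: power_strict_mono)
  have m: "m t = a\<^sup>2 - t * (a\<^sup>2 - b\<^sup>2)" for t by (simp add: m_def algebra_simps)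
  have mpos: "0 < m t" if "0 \<le> t" "t \<le> 1" for t
  proof -
    have "t * (a\<^sup>2 - b\<^sup>2) \<le> 1 * (a\<^sup>2 - b\<^sup>2)" using that ab by (intro mult_right_mono) auto
    also have "\<dots> < a\<^sup>2" using ab by simp
    finally show ?thesis by (simp add: m)
  qed
  have dm: "(m has_real_derivative - (a\<^sup>2 - b\<^sup>2)) (at t)" for t
    unfolding m[abs_def] by (auto intro!: derivative_eq_intros)
  have dk: "(k has_real_derivative k1 t) (at t)" if "0 \<le> t" "t \<le> 1" for t
    unfolding k_def[abs_def] using mpos[OF that]
    by (auto intro!: derivative_eq_intros dm simp: k1_def algebra_simps)
  have dk1: "(k1 has_real_derivative k2 t) (at t)" if "0 \<le> t" "t \<le> 1" for t
    unfolding k1_def[abs_def] using mpos[OF that]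
    by (auto intro!: derivative_eq_intros dm simp: k2_def power2_eq_square divide_simps) (simp add: algebra_simps)
  have k2_mono: "k2 s < k2 t" if "0 \<le> s" "s < t" "t \<le> 1" for s t
  proof -
    have "m t < m s" using that ab by (simp add: m)
    then show ?thesis using mpos[of t] mpos[of s] that ab
      by (auto simp: k2_def intro!: divide_strict_left_mono)
  qed
  have k0: "k 0 = 0" "k 1 = 0" by (simp_all add: k_def m_def)
  have "(a\<^sup>2 * ln (a\<^sup>2) + b\<^sup>2 * ln (b\<^sup>2)) / 2 - (a\<^sup>2 + b\<^sup>2) / 2 * ln ((a\<^sup>2 + b\<^sup>2) / 2)
    \<le> (a - b)\<^sup>2 / 2"
    using assms by (intro log_sobolev_symmetric)
  then have khalf: "0 \<le> k (1 / 2)"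
    by (simp add: k_def m_def field_simps)
  \<comment> \<open>A negative value of \<open>k\<close> on \<open>(0, 1/2)\<close> would make \<open>k''\<close> first positive and then negative.\<close>
  have "0 \<le> k \<theta>"
  proof (rule ccontr)
    assume "\<not> 0 \<le> k \<theta>"
    then have neg: "k \<theta> < 0" by simp
    then have "\<theta> \<noteq> 0" "\<theta> \<noteq> 1 / 2"
      using neg k0 khalf by (metis less_irrefl, metis not_le)
    then have \<theta>: "0 < \<theta>" "\<theta> < 1 / 2"
      using assms by simp_all
    obtain z1 where z1: "0 < z1" "z1 < \<theta>" "k \<theta> - k 0 = (\<theta> - 0) * k1 z1"
      using MVT2[of 0 \<theta> k k1] dk \<theta> by auto
    obtain z2 where z2: "\<theta> < z2" "z2 < 1 / 2" "k (1 / 2) - k \<theta> = (1 / 2 - \<theta>) * k1 z2"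
      using MVT2[of \<theta> "1 / 2" k k1] dk \<theta> by auto
    obtain z3 where z3: "1 / 2 < z3" "z3 < 1" "k 1 - k (1 / 2) = (1 - 1 / 2) * k1 z3"
      using MVT2[of "1 / 2" 1 k k1] dk by auto
    have s1: "k1 z1 < 0" using z1 neg k0 \<theta> by (smt (verit) mult_nonneg_nonneg)
    have s2: "0 < k1 z2" using z2 neg khalf \<theta> by (smt (verit) mult_nonneg_nonpos)
    have s3: "k1 z3 \<le> 0" using z3 k0 khalf by simp
    obtain e1 where e1: "z1 < e1" "e1 < z2" "k1 z2 - k1 z1 = (z2 - z1) * k2 e1"
      using MVT2[of z1 z2 k1 k2] dk1 z1 z2 \<theta> by auto
    obtain e2 where e2: "z2 < e2" "e2 < z3" "k1 z3 - k1 z2 = (z3 - z2) * k2 e2"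
      using MVT2[of z2 z3 k1 k2] dk1 z1 z2 z3 \<theta> by auto
    have "0 < k2 e1" using e1 s1 s2 by (smt (verit) mult_nonneg_nonpos)
    moreover have "k2 e2 < 0" using e2 s2 s3 by (smt (verit) mult_nonneg_nonneg)
    moreover have "k2 e1 < k2 e2" using e1 e2 z1 z3 by (intro k2_mono) auto
    ultimately show False by simp
  qed
  then show ?thesis by (simp add: k_def m_def)
qed

text \<open>The two-point inequality is applied to \<open>A powr (s / 2)\<close> and
  \<open>B powr (s / 2)\<close> with mass \<open>1 - l\<close> at the smaller value; the squared
  difference is then bounded by the Stroock-Varopoulos inequality.\<close>

lemma entropy_powr_le:
  fixes A B s l :: real
  assumes "0 < B" "B < A" "1 < s" "1 / 2 \<le> l" "l < 1"
  defines "M \<equiv> l * A powr s + (1 - l) * B powr s"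
  shows "s * (l * A powr s * ln A + (1 - l) * B powr s * ln B) - M * ln M
    \<le> s\<^sup>2 / (2 * (s - 1)) * (l * (1 - l)) * (A - B) * (A powr (s - 1) - B powr (s - 1))"
proof -
  define a b where "a = A powr (s / 2)" and "b = B powr (s / 2)"
  have sq: "A powr s = a\<^sup>2" "B powr s = b\<^sup>2"
    by (simp_all add: a_def b_def power2_eq_square flip: powr_add)
  have ab: "0 < b" "b < a" using assms by (auto simp: a_def b_def powr_less_mono2)
  have ln_sq: "ln (a\<^sup>2) = s * ln A" "ln (b\<^sup>2) = s * ln B"
    using assms by (simp_all add: sq[symmetric])
  have "(1 - l) * b\<^sup>2 * ln (b\<^sup>2) + (1 - (1 - l)) * a\<^sup>2 * ln (a\<^sup>2)
      - ((1 - l) * b\<^sup>2 + (1 - (1 - l)) * a\<^sup>2) * ln ((1 - l) * b\<^sup>2 + (1 - (1 - l)) * a\<^sup>2)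
    \<le> 2 * (1 - l) * (1 - (1 - l)) * (a - b)\<^sup>2"
    using assms ab by (intro log_sobolev_two_point) auto
  then have "s * (l * A powr s * ln A + (1 - l) * B powr s * ln B) - M * ln M
    \<le> 2 * (l * (1 - l)) * (a - b)\<^sup>2"
    unfolding ln_sq M_def by (simp add: sq algebra_simps)
  also have "\<dots> \<le> 2 * (l * (1 - l)) *
      (s\<^sup>2 / (4 * (s - 1)) * (A - B) * (A powr (s - 1) - B powr (s - 1)))"
    unfolding a_def b_def using assms by (intro mult_left_mono powr_half_diff_sq_le) auto
  also have "\<dots> = s\<^sup>2 / (2 * (s - 1)) * (l * (1 - l)) * (A - B) * (A powr (s - 1) - B powr (s - 1))"
    using assms by (simp add: field_simps)
  finally show ?thesis .
qed

text \<open>Gross's argument: the exponent moves from \<open>p\<close> to \<open>q\<close> while the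
  parameter shrinks, and the logarithm of the norm decreases along the way. As
  \<open>l \<ge> 1 / 2\<close> and \<open>t \<ge> 0\<close>, the larger value sits on the heavier
  atom, as the entropy inequality requires.\<close>

lemma lognorm_contraction_large_atom:
  assumes "1 / 2 \<le> l" "l < 1" "1 < p" "p < q" "0 \<le> t" "l * t \<le> 1"
  shows "lognorm l q (sqrt ((p - 1) / (q - 1)) * t) \<le> lognorm l p t"
proof -
  have l: "0 < l" using assms by simp
  have interior: "lognorm l q (sqrt ((p - 1) / (q - 1)) * t) \<le> lognorm l p t"
    if t: "0 < t" "l * t < 1" for t
  proof -
    \<comment> \<open>This curve starts at \<open>w p = t\<close>, ends at the contracted parameter
      for \<open>s = q\<close>, and solves \<open>w' = - w / (2 * (s - 1))\<close>.\<close>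
    define w where "w s = sqrt (p - 1) * t * (s - 1) powr (- 1 / 2)" for s
    define M where "M s = l * (1 + (1 - l) * w s) powr s + (1 - l) * (1 - l * w s) powr s" for s
    have w_eq: "w s = sqrt ((p - 1) / (s - 1)) * t" if "p \<le> s" for s
      using that assms by (simp add: w_def powr_minus powr_half_sqrt real_sqrt_divide field_simps)
    have w_pos: "0 < w s" if "p \<le> s" for s
      using that assms t by (simp add: w_def)
    have w_le: "w s \<le> t" if "p \<le> s" for s
    proof -
      have "sqrt ((p - 1) / (s - 1)) \<le> 1" using that assms by simp
      then show ?thesis using w_eq[OF that] t by (simp add: mult_le_cancel_right1)
    qed
    have lw: "0 < 1 - l * w s" if "p \<le> s" for s
      using mult_left_mono[OF w_le[OF that], of l] l t by linarith
    have M_eq: "mom l s (w s) = M s" if "p \<le> s" for s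
      using lw[OF that] w_pos[OF that] assms by (simp add: mom_def M_def add_nonneg_nonneg)
    have M_pos: "0 < M s" if "p \<le> s" for s
      using M_eq[OF that] mom_pos[of l s "w s"] l assms by simp
    have dw: "(w has_real_derivative - w s / (2 * (s - 1))) (at s)" if "p \<le> s" for s
    proof -
      have "(s - 1) powr (- 1 / 2 - 1) = (s - 1) powr (- 1 / 2) / (s - 1)"
        using that assms by (simp only: powr_diff) simp
      then show ?thesis unfolding w_def[abs_def] using that assms
        by (auto intro!: derivative_eq_intros)
    qed
    have "(\<lambda>s. ln (M s) / s) q \<le> (\<lambda>s. ln (M s) / s) p"
    proof (rule DERIV_nonpos_imp_nonincreasing[where f = "\<lambda>s. ln (M s) / s"])
      show "p \<le> q" using assms by simp
      fix s assume s: "p \<le> s" "s \<le> q"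
      then have s1: "1 < s" using assms by simp
      define A B where "A = 1 + (1 - l) * w s" and "B = 1 - l * w s"
      define v where "v = w s / (2 * (s - 1))"
      have dv: "(w has_real_derivative - v) (at s)"
        using dw[OF s(1)] by (simp add: v_def)
      have B: "0 < B" using lw[OF s(1)] by (simp add: B_def)
      have AB: "A - B = w s" by (simp add: A_def B_def algebra_simps)
      have BA: "B < A" using AB w_pos[OF s(1)] by simp
      define D where "D = l * A powr s * ln A + (1 - l) * B powr s * ln B
        - s * (l * (1 - l)) * v * (A powr (s - 1) - B powr (s - 1))"
      have Ms: "M s = l * A powr s + (1 - l) * B powr s" by (simp add: M_def A_def B_def)
      have dA: "((\<lambda>s. (1 + (1 - l) * w s) powr s) has_real_derivative
          A powr s * (ln A + (1 - l) * (- v) * s / A)) (at s)"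
      proof -
        have "((\<lambda>s. 1 + (1 - l) * w s) has_real_derivative (1 - l) * (- v)) (at s)"
          using dv by (auto intro!: derivative_eq_intros)
        from DERIV_powr[OF this _ DERIV_ident] show ?thesis using B BA by (simp add: A_def)
      qed
      have dB: "((\<lambda>s. (1 - l * w s) powr s) has_real_derivative
          B powr s * (ln B + (- l * (- v)) * s / B)) (at s)"
      proof -
        have "((\<lambda>s. 1 - l * w s) has_real_derivative - l * (- v)) (at s)"
          using dv by (auto intro!: derivative_eq_intros)
        from DERIV_powr[OF this _ DERIV_ident] show ?thesis using B by (simp add: B_def)
      qed
      have "(M has_real_derivative
          l * (A powr s * (ln A + (1 - l) * (- v) * s / A))
          + (1 - l) * (B powr s * (ln B + (- l * (- v)) * s / B))) (at s)"
        unfolding M_def[abs_def] by (intro DERIV_add DERIV_cmult dA dB)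
      also have "l * (A powr s * (ln A + (1 - l) * (- v) * s / A))
          + (1 - l) * (B powr s * (ln B + (- l * (- v)) * s / B)) = D"
        using B BA unfolding D_def powr_diff
          by (simp add: algebra_simps add_divide_distrib diff_divide_distrib)
      finally have "((\<lambda>s. ln (M s) / s) has_real_derivative (s * D - M s * ln (M s)) / (s\<^sup>2 * M s)) (at s)"
        using s1 M_pos[OF s(1)]
        by (auto intro!: derivative_eq_intros simp: field_simps power2_eq_square)
      \<comment> \<open>Since \<open>A - B = w s\<close>, the term of \<open>s * D\<close>
        containing \<open>v\<close> is exactly the right-hand side of the entropy
        inequality.\<close>
      moreover have "s * D - M s * ln (M s) \<le> 0"
        using entropy_powr_le[OF B BA s1 assms(1,2)] s1 unfolding AB Ms[symmetric] D_def v_def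
        by (simp add: field_simps power2_eq_square)
      then have "(s * D - M s * ln (M s)) / (s\<^sup>2 * M s) \<le> 0"
        using M_pos[OF s(1)] by (intro divide_nonpos_nonneg) auto
      ultimately show "\<exists>y. ((\<lambda>s. ln (M s) / s) has_real_derivative y) (at s) \<and> y \<le> 0" by blast
    qed
    then show ?thesis
      using w_eq[of p] w_eq[of q] M_eq[of p] M_eq[of q] assms by (simp add: lognorm_def)
  qed
  show ?thesis
  proof (cases "t = 0")
    case False
    \<comment> \<open>Continuity extends the estimate from the open interval to the endpoint
      \<open>l * t = 1\<close>, where one value vanishes.\<close>
    define F where "F t = lognorm l p t - lognorm l q (sqrt ((p - 1) / (q - 1)) * t)" for t
    have "0 \<le> F t"
    proof (rule continuous_ge_on_closure[of "{0<..<1 / l}" F])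
      show "continuous_on (closure {0<..<1 / l}) F"
        unfolding F_def[abs_def] using assms l
        by (intro continuous_intros continuous_on_lognorm
            continuous_on_compose2[OF continuous_on_lognorm[of l q UNIV]]) auto
      show "t \<in> closure {0<..<1 / l}" using assms l by (simp add: field_simps)
      show "0 \<le> F u" if "u \<in> {0<..<1 / l}" for u
        using interior[of u] that l by (simp add: F_def field_simps)
    qed
    then show ?thesis by (simp add: F_def)
  qed simp
qed

subsection \<open>Expansion at the origin\<close>

text \<open>The mean of \<open>X\<close> is 0, so the terms of order two and three come directly
  from the second moment \<open>l * (1 - l)\<close> and the third moment
  \<open>l * (1 - l) * (1 - 2 * l)\<close>.\<close>

lemma lognorm_third_order:
  assumes "0 < l" "l < 1" "1 < p"
  shows "((\<lambda>t. (lognorm l p t - (p - 1) * l * (1 - l) / 2 * t\<^sup>2) / t ^ 3)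
    \<longlongrightarrow> (p - 1) * (p - 2) * l * (1 - l) * (1 - 2 * l) / 6) (at_right 0)"
  unfolding lognorm_def mom_def using assms by (real_asymp simp: field_simps)

lemma lognorm_second_order:
  assumes "0 < l" "l < 1" "1 < p"
  shows "((\<lambda>t. lognorm l p t / t\<^sup>2) \<longlongrightarrow> (p - 1) * l * (1 - l) / 2) (at_right 0)"
  unfolding lognorm_def mom_def using assms by (real_asymp simp: field_simps)

lemma filterlim_mult_at_right_0:
  fixes r :: real
  assumes "0 < r"
  shows "filterlim (\<lambda>t. r * t) (at_right 0) (at_right 0)"
  using assms by real_asymp

text \<open>The second-order coefficients decide, because
  \<open>r\<^sup>2 * (q - 1) < p - 1\<close>.\<close>

lemma eventually_lognorm_less:
  assumes "0 < l" "l < 1" "1 < p" "p < q" "0 < r" "r < sqrt ((p - 1) / (q - 1))"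
  shows "\<forall>\<^sub>F t in at_right 0. lognorm l q (r * t) < lognorm l p t"
proof -
  have "r\<^sup>2 < (sqrt ((p - 1) / (q - 1)))\<^sup>2" using assms by (intro power_strict_mono) auto
  then have r: "r\<^sup>2 * (q - 1) < p - 1" using assms by (simp add: field_simps)
  have "((\<lambda>t. r\<^sup>2 * (lognorm l q (r * t) / (r * t)\<^sup>2)) \<longlongrightarrow> r\<^sup>2 * ((q - 1) * l * (1 - l) / 2)) (at_right 0)"
    using assms by (intro tendsto_mult_left filterlim_compose[OF lognorm_second_order filterlim_mult_at_right_0]) auto
  also have "(\<lambda>t. r\<^sup>2 * (lognorm l q (r * t) / (r * t)\<^sup>2)) = (\<lambda>t. lognorm l q (r * t) / t\<^sup>2)"
    using assms by (auto simp: power_mult_distrib)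
  finally have lim: "((\<lambda>t. lognorm l p t / t\<^sup>2 - lognorm l q (r * t) / t\<^sup>2)
      \<longlongrightarrow> (p - 1) * l * (1 - l) / 2 - r\<^sup>2 * ((q - 1) * l * (1 - l) / 2)) (at_right 0)"
    using assms by (intro tendsto_diff lognorm_second_order) auto
  have "(p - 1) * l * (1 - l) / 2 - r\<^sup>2 * ((q - 1) * l * (1 - l) / 2)
      = (l * (1 - l) / 2) * (p - 1 - r\<^sup>2 * (q - 1))" by (simp add: field_simps)
  also have "\<dots> > 0" using assms r by simp
  finally have "\<forall>\<^sub>F t in at_right 0. 0 < lognorm l p t / t\<^sup>2 - lognorm l q (r * t) / t\<^sup>2"
    using lim by (rule order_tendstoD(1)[rotated])
  moreover have "\<forall>\<^sub>F t::real in at_right 0. 0 < t" by (simp add: eventually_at_right_less)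
  ultimately show ?thesis
    by eventually_elim (auto simp: divide_less_cancel)
qed

text \<open>At this ratio the second-order terms cancel. The third-order difference is positive
  because \<open>l < 1 / 2\<close> makes the skewness positive and
  \<open>p - 2 < r * (q - 2)\<close>.\<close>

lemma eventually_lognorm_greater:
  assumes "0 < l" "l < 1 / 2" "1 < p" "p < q"
  shows "\<forall>\<^sub>F t in at_right 0. lognorm l p t < lognorm l q (sqrt ((p - 1) / (q - 1)) * t)"
proof -
  define r where "r = sqrt ((p - 1) / (q - 1))"
  have r0: "0 < r" using assms by (simp add: r_def)
  have r2: "r\<^sup>2 * (q - 1) = p - 1" using assms by (simp add: r_def)
  have r3: "r ^ 3 * (q - 1) = (p - 1) * r" using r2 by (simp add: power3_eq_cube power2_eq_square)
  \<comment> \<open>In terms of the square roots \<open>x\<close>, \<open>y\<close> of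
    \<open>p - 1\<close>, \<open>q - 1\<close>, the claim becomes
    \<open>0 < (y - x) * (x * y + 1)\<close>.\<close>
  have key: "p - 2 < r * (q - 2)"
  proof -
    define x y where "x = sqrt (p - 1)" and "y = sqrt (q - 1)"
    have xy: "0 < x" "x < y" "x\<^sup>2 = p - 1" "y\<^sup>2 = q - 1" using assms by (simp_all add: x_def y_def)
    have "p - 2 = ((x\<^sup>2 - 1) * y) / y" "r * (q - 2) = (x * (y\<^sup>2 - 1)) / y"
      using xy by (simp_all add: r_def x_def y_def real_sqrt_divide)
    moreover have "(x\<^sup>2 - 1) * y < x * (y\<^sup>2 - 1)"
    proof -
      have "x * (y\<^sup>2 - 1) - (x\<^sup>2 - 1) * y = (y - x) * (x * y + 1)"
        by (simp add: algebra_simps power2_eq_square)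
      moreover have "0 < (y - x) * (x * y + 1)" using xy by (simp add: add_pos_pos)
      ultimately show ?thesis by simp
    qed
    ultimately show ?thesis using xy by (metis divide_strict_right_mono order_less_trans)
  qed
  define c where "c p = (p - 1) * l * (1 - l) / 2" for p
  define d where "d p = (p - 1) * (p - 2) * l * (1 - l) * (1 - 2 * l) / 6" for p
  have lim: "((\<lambda>t. (lognorm l p t - c p * t\<^sup>2) / t ^ 3) \<longlongrightarrow> d p) (at_right 0)" if "1 < p" for p
    unfolding c_def d_def using assms that by (intro lognorm_third_order) auto
  have "((\<lambda>t. r ^ 3 * ((lognorm l q (r * t) - c q * (r * t)\<^sup>2) / (r * t) ^ 3)) \<longlongrightarrow> r ^ 3 * d q) (at_right 0)"
    using assms r0 by (intro tendsto_mult_left filterlim_compose[OF lim filterlim_mult_at_right_0]) auto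
  moreover have "r ^ 3 * ((lognorm l q (r * t) - c q * (r * t)\<^sup>2) / (r * t) ^ 3)
      = (lognorm l q (r * t) - c p * t\<^sup>2) / t ^ 3" for t
  proof -
    have "c q * (r * t)\<^sup>2 = (r\<^sup>2 * (q - 1)) * (l * (1 - l) / 2) * t\<^sup>2"
      by (simp add: c_def power_mult_distrib)
    also have "\<dots> = c p * t\<^sup>2" by (simp add: r2 c_def)
    finally have "c q * (r * t)\<^sup>2 = c p * t\<^sup>2" .
    then show ?thesis using r0 by (simp only:) (simp add: power_mult_distrib)
  qed
  ultimately have "((\<lambda>t. (lognorm l q (r * t) - c p * t\<^sup>2) / t ^ 3) \<longlongrightarrow> r ^ 3 * d q) (at_right 0)"
    by simp
  then have lim': "((\<lambda>t. (lognorm l q (r * t) - c p * t\<^sup>2) / t ^ 3 - (lognorm l p t - c p * t\<^sup>2) / t ^ 3)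
      \<longlongrightarrow> r ^ 3 * d q - d p) (at_right 0)"
    using assms by (intro tendsto_diff lim) auto
  have "r ^ 3 * d q - d p = (p - 1) * (l * (1 - l) * (1 - 2 * l) / 6) * (r * (q - 2) - (p - 2))"
  proof -
    have "r ^ 3 * d q = (r ^ 3 * (q - 1)) * (q - 2) * (l * (1 - l) * (1 - 2 * l) / 6)"
      by (simp add: d_def)
    then show ?thesis unfolding r3 by (simp add: d_def field_simps)
  qed
  also have "\<dots> > 0"
    using assms key by simp
  finally have "\<forall>\<^sub>F t in at_right 0.
      0 < (lognorm l q (r * t) - c p * t\<^sup>2) / t ^ 3 - (lognorm l p t - c p * t\<^sup>2) / t ^ 3"
    using lim' by (rule order_tendstoD(1)[rotated])
  moreover have "\<forall>\<^sub>F t::real in at_right 0. 0 < t" by (simp add: eventually_at_right_less)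
  ultimately show ?thesis unfolding r_def[symmetric]
    by eventually_elim (auto simp: divide_less_cancel)
qed

subsection \<open>Existence of an extremal function\<close>

text \<open>With \<open>m \<ge> 1\<close> the mean of \<open>\<bar>1 + t * X\<bar>\<close>, this
  absolute value equals \<open>m * (1 + u * X)\<close>. By the triangle inequality
  \<open>\<bar>1 + r * t * X\<bar>\<close> is at most \<open>m * (1 + r * u * X)\<close>, so passing
  from \<open>t\<close> to \<open>u\<close> only strengthens the claim. The sign of \<open>u\<close>
  selects one of the two assumed inequalities.\<close>

lemma lognorm_contraction_of_nonneg:
  assumes "0 < l" "l < 1" "1 < p" "p < q" "0 \<le> r" "r \<le> 1"
    and right: "\<And>t. 0 \<le> t \<Longrightarrow> l * t \<le> 1 \<Longrightarrow> lognorm l q (r * t) \<le> lognorm l p t"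
    and left: "\<And>t. 0 \<le> t \<Longrightarrow> (1 - l) * t \<le> 1 \<Longrightarrow>
      lognorm (1 - l) q (r * t) \<le> lognorm (1 - l) p t"
  shows "lognorm l q (r * t) \<le> lognorm l p t"
proof -
  define a b where "a = 1 + (1 - l) * t" and "b = 1 - l * t"
  define m where "m = l * \<bar>a\<bar> + (1 - l) * \<bar>b\<bar>"
  define u where "u = (\<bar>a\<bar> - \<bar>b\<bar>) / m"
  have "1 = l * a + (1 - l) * b" by (simp add: a_def b_def algebra_simps)
  also have "\<dots> \<le> m"
    unfolding m_def using assms by (intro add_mono mult_left_mono) auto
  finally have m1: "1 \<le> m" .
  have a: "\<bar>a\<bar> = m * (1 + (1 - l) * u)" and b: "\<bar>b\<bar> = m * (1 - l * u)"
    using m1 by (simp_all add: u_def field_simps) (simp_all add: m_def algebra_simps)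
  have pa: "0 \<le> 1 + (1 - l) * u" and pb: "0 \<le> 1 - l * u"
    using a b m1 by (metis abs_ge_zero zero_le_mult_iff not_one_le_zero order_trans)+
  have "mom l p t = m powr p * mom l p u"
  proof -
    have "(m * x) powr p = m powr p * x powr p" if "0 \<le> x" for x
      using m1 that by (simp add: powr_mult)
    then show ?thesis
      unfolding mom_def a_def[symmetric] b_def[symmetric] a b abs_of_nonneg[OF pa] abs_of_nonneg[OF pb]
      by (simp only: pa pb distrib_left[of "m powr p"] mult.left_commute[of _ "m powr p"])
  qed
  then have np: "lognorm l p t = ln m + lognorm l p u"
    using m1 mom_pos[of l p u] assms by (simp add: lognorm_def ln_mult ln_powr field_simps)
  have ra: "\<bar>1 + (1 - l) * (r * t)\<bar> \<le> m * (1 + (1 - l) * (r * u))"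
  proof -
    have "1 + (1 - l) * (r * t) = (1 - r) * 1 + r * a" by (simp add: a_def algebra_simps)
    also have "\<bar>\<dots>\<bar> \<le> (1 - r) * 1 + r * \<bar>a\<bar>"
      using assms by (intro order_trans[OF abs_triangle_ineq]) (simp add: abs_mult)
    also have "\<dots> \<le> (1 - r) * m + r * \<bar>a\<bar>"
      using assms m1 by (intro add_mono mult_left_mono) auto
    finally show ?thesis unfolding a by (simp add: algebra_simps)
  qed
  have rb: "\<bar>1 - l * (r * t)\<bar> \<le> m * (1 - l * (r * u))"
  proof -
    have "1 - l * (r * t) = (1 - r) * 1 + r * b" by (simp add: b_def algebra_simps)
    also have "\<bar>\<dots>\<bar> \<le> (1 - r) * 1 + r * \<bar>b\<bar>"
      using assms by (intro order_trans[OF abs_triangle_ineq]) (simp add: abs_mult)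
    also have "\<dots> \<le> (1 - r) * m + r * \<bar>b\<bar>"
      using assms m1 by (intro add_mono mult_left_mono) auto
    finally show ?thesis unfolding b by (simp add: algebra_simps)
  qed
  have nn: "0 \<le> 1 + (1 - l) * (r * u)" "0 \<le> 1 - l * (r * u)"
    using ra rb m1 by (smt (verit) mult_pos_neg)+
  have "mom l q (r * t) \<le> l * (m * (1 + (1 - l) * (r * u))) powr q
      + (1 - l) * (m * (1 - l * (r * u))) powr q"
    unfolding mom_def using ra rb assms by (intro add_mono mult_left_mono powr_mono2) auto
  also have "\<dots> = m powr q * mom l q (r * u)"
  proof -
    have "(m * x) powr q = m powr q * x powr q" if "0 \<le> x" for x
      using m1 that by (simp add: powr_mult)
    then show ?thesis
      unfolding mom_def abs_of_nonneg[OF nn(1)] abs_of_nonneg[OF nn(2)]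
      by (simp only: nn distrib_left[of "m powr q"] mult.left_commute[of _ "m powr q"])
  qed
  finally have "ln (mom l q (r * t)) \<le> ln (m powr q * mom l q (r * u))"
    using mom_pos[of l q "r * t"] mom_pos[of l q "r * u"] m1 assms by simp
  then have nq: "lognorm l q (r * t) \<le> ln m + lognorm l q (r * u)"
    using m1 mom_pos[of l q "r * u"] assms by (simp add: lognorm_def ln_mult ln_powr field_simps)
  have "lognorm l q (r * u) \<le> lognorm l p u"
  proof (cases "0 \<le> u")
    case True
    then show ?thesis using right pb by simp
  next
    case False
    then show ?thesis
      using left[of "- u"] pa lognorm_uminus[of l q "r * (- u)"] lognorm_uminus[of l q "- (r * u)"]
        lognorm_uminus[of l p "- u"] lognorm_uminus[of "1 - l" q "r * u"] lognorm_uminus[of "1 - l" p u]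
      by simp
  qed
  then show ?thesis using np nq by simp
qed

section \<open>The hypercontractivity constant in terms of logarithmic norms\<close>

lemma Lp_norm_biased_bernoulli:
  assumes "0 < l" "l < 1" "0 < p"
  shows "Lp_norm (measure_pmf (bernoulli_pmf l)) p (\<lambda>\<omega>. 1 + t * biased_bernoulli l \<omega>)
    = exp (lognorm l p t)"
proof -
  have "(LINT \<omega>|measure_pmf (bernoulli_pmf l). \<bar>1 + t * biased_bernoulli l \<omega>\<bar> powr p) = mom l p t"
    using assms by (simp add: mom_def biased_bernoulli_def mult.commute)
  then show ?thesis
    using mom_pos[OF assms(1,2), of p t] by (simp add: Lp_norm_def powr_def lognorm_def)
qed

lemma hypercontractive_biased_bernoulli_iff:
  assumes "0 < l" "l < 1"
  shows "hypercontractive (measure_pmf (bernoulli_pmf l)) (biased_bernoulli l) p q r \<longleftrightarrow>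
    1 < p \<and> p < q \<and> 0 \<le> r \<and> r < 1 \<and> (\<forall>t. lognorm l q (r * t) \<le> lognorm l p t)"
  (is "?L \<longleftrightarrow> ?R")
proof -
  have "(\<forall>t. Lp_norm (measure_pmf (bernoulli_pmf l)) q (\<lambda>\<omega>. 1 + r * t * biased_bernoulli l \<omega>)
      \<le> Lp_norm (measure_pmf (bernoulli_pmf l)) p (\<lambda>\<omega>. 1 + t * biased_bernoulli l \<omega>))
    \<longleftrightarrow> (\<forall>t. lognorm l q (r * t) \<le> lognorm l p t)" if "1 < p" "p < q"
    using Lp_norm_biased_bernoulli[OF assms, of q] Lp_norm_biased_bernoulli[OF assms, of p] that
    by simp
  moreover have "integrable (measure_pmf (bernoulli_pmf l)) (\<lambda>\<omega>. \<bar>biased_bernoulli l \<omega>\<bar> powr q)"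
    by (rule integrable_measure_pmf_finite) simp
  ultimately show ?thesis
    unfolding hypercontractive_def by (auto simp: prob_space_measure_pmf)
qed

text \<open>A point of equality certifies maximality: by strict monotonicity, any \<open>r\<close>
  in \<open>(s, 1)\<close> violates the inequality at the same \<open>t\<close>.\<close>

lemma bernoulli_hc_const_eqI:
  assumes "0 < l" "l < 1" "1 < p" "p < q" "0 \<le> s" "s < 1"
    and contr: "\<And>t. lognorm l q (s * t) \<le> lognorm l p t"
    and t: "0 < t" "l * t \<le> 1" "lognorm l q (s * t) = lognorm l p t"
  shows "bernoulli_hc_const p q l = s"
  unfolding bernoulli_hc_const_def hc_const_def
proof (rule Greatest_equality)
  show "hypercontractive (measure_pmf (bernoulli_pmf l)) (biased_bernoulli l) p q s"
    using assms by (simp add: hypercontractive_biased_bernoulli_iff)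
  fix r
  assume "hypercontractive (measure_pmf (bernoulli_pmf l)) (biased_bernoulli l) p q r"
  then have r: "r < 1" "lognorm l q (r * t) \<le> lognorm l p t"
    using assms by (auto simp: hypercontractive_biased_bernoulli_iff)
  show "r \<le> s"
  proof (rule ccontr)
    assume "\<not> r \<le> s"
    then have "s * t < r * t" "r * t < t" using t r by simp_all
    moreover have "l * (r * t) \<le> l * t" using assms(1) \<open>r * t < t\<close> by simp
    then have "l * (r * t) \<le> 1" using t by linarith
    ultimately have "lognorm l q (s * t) < lognorm l q (r * t)"
      using assms t by (intro lognorm_strict_mono) auto
    then show False using t r by simp
  qed
qed

text \<open>The constant \<open>s\<close> is the least \<open>r\<close> for which the inequality is
  an equality or fails at some admissible positive parameter. Compactness yields it once these
  parameters are kept away from 0.\<close>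

lemma lognorm_extremal_exists:
  assumes "0 < l" "l < 1 / 2" "1 < p" "p < q"
  obtains s t where "0 < s" "s < 1" "0 < t" "l * t \<le> 1"
    "\<And>u. lognorm l q (s * u) \<le> lognorm l p u" "lognorm l q (s * t) = lognorm l p t"
proof -
  define R where "R = sqrt ((p - 1) / (q - 1))"
  have R: "0 < R" "R < 1" using assms by (simp_all add: R_def)
  have mono: "lognorm k q (r * u) \<le> lognorm k q (r' * u)"
    if "0 < k" "k < 1" "0 \<le> r" "r \<le> r'" "r' \<le> 1" "0 \<le> u" "k * u \<le> 1" for k r r' u
  proof (cases "r * u = r' * u")
    case False
    have "r * u \<le> r' * u" "r' * u \<le> 1 * u" using that by (intro mult_right_mono; simp)+
    moreover have "k * (r' * u) \<le> k * u" using that \<open>r' * u \<le> 1 * u\<close> by simp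
    then have "k * (r' * u) \<le> 1" using that by linarith
    moreover have "0 \<le> r * u" using that by simp
    ultimately show ?thesis
      using that(1,2) False assms by (intro less_imp_le[OF lognorm_strict_mono]) linarith+
  qed (simp only: order_refl)
  have cont: "continuous_on S (\<lambda>z. lognorm l p (snd z) - lognorm l q (fst z * snd z))"
    for S :: "(real \<times> real) set"
    using assms by (intro continuous_intros
        continuous_on_compose2[OF continuous_on_lognorm[of l p UNIV]]
        continuous_on_compose2[OF continuous_on_lognorm[of l q UNIV]]) auto
  have "\<forall>\<^sub>F t in at_right 0. lognorm l p t < lognorm l q (R * t)"
    unfolding R_def using assms by (rule eventually_lognorm_greater)
  moreover have "\<forall>\<^sub>F t in at_right 0. t \<in> {0<..<1 / l}"
    using assms by (intro eventually_at_right_real) simp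
  ultimately have "\<forall>\<^sub>F t in at_right 0. lognorm l p t < lognorm l q (R * t) \<and> t \<in> {0<..<1 / l}"
    by eventually_elim simp
  then obtain t0 where t0: "lognorm l p t0 < lognorm l q (R * t0)" "0 < t0" "t0 < 1 / l"
    using eventually_happens'[OF trivial_limit_at_right_real] by auto
  \<comment> \<open>Strict failure at \<open>t0\<close> persists for some \<open>r1\<close> slightly
    below \<open>R\<close>, and \<open>r1 < R\<close> is what the second-order comparison near the
    origin requires.\<close>
  have "((\<lambda>r. lognorm l p t0 - lognorm l q (r * t0)) \<longlongrightarrow> lognorm l p t0 - lognorm l q (R * t0)) (at_left R)"
  proof -
    have "continuous_on UNIV (\<lambda>r. lognorm l p t0 - lognorm l q (r * t0))"
      using assms by (intro continuous_intros continuous_on_compose2[OF continuous_on_lognorm[of l q UNIV]]) auto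
    then show ?thesis
      by (simp add: continuous_on_eq_continuous_at isCont_def filterlim_at_split)
  qed
  then have "\<forall>\<^sub>F r in at_left R. lognorm l p t0 - lognorm l q (r * t0) < 0"
    using t0 by (intro order_tendstoD(2)) auto
  moreover have "\<forall>\<^sub>F r in at_left R. r \<in> {0<..<R}"
    using R by (intro eventually_at_left_real)
  ultimately have "\<forall>\<^sub>F r in at_left R. lognorm l p t0 - lognorm l q (r * t0) < 0 \<and> r \<in> {0<..<R}"
    by eventually_elim simp
  then obtain r1 where r1: "lognorm l p t0 < lognorm l q (r1 * t0)" "0 < r1" "r1 < R"
    using eventually_happens'[OF trivial_limit_at_left_real] by auto
  have "\<forall>\<^sub>F t in at_right 0. lognorm l q (r1 * t) < lognorm l p t"
    using assms r1 unfolding R_def by (intro eventually_lognorm_less) auto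
  then obtain d where d: "0 < d" "\<And>t. 0 < t \<Longrightarrow> t < d \<Longrightarrow> lognorm l q (r1 * t) < lognorm l p t"
    unfolding eventually_at_right_field by auto
  have "d \<le> t0" using d(2)[of t0] t0 r1 by force
  \<comment> \<open>Pairs where the strict inequality fails. The bound \<open>d\<close> excludes the
    origin, where equality always holds, and makes the set compact.\<close>
  define W where "W = ({0..r1} \<times> {d..1 / l}) \<inter>
    (\<lambda>z. lognorm l p (snd z) - lognorm l q (fst z * snd z)) -` {..0}"
  have W: "compact W"
    unfolding W_def
    by (intro compact_Int_closed compact_Times compact_Icc closed_vimage closed_atMost cont)
  have "(r1, t0) \<in> W" using \<open>d \<le> t0\<close> t0 r1 by (auto simp: W_def)
  then have "W \<noteq> {}" by blast
  with W have "\<exists>z\<in>W. \<forall>y\<in>W. fst z \<le> fst y"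
    by (rule continuous_attains_inf) (rule continuous_on_fst[OF continuous_on_id])
  then obtain z where z: "z \<in> W" "\<And>y. y \<in> W \<Longrightarrow> fst z \<le> fst y"
    by auto
  obtain s t where st: "z = (s, t)" by (cases z)
  have zst: "0 \<le> s" "s \<le> r1" "d \<le> t" "t \<le> 1 / l" "lognorm l p t \<le> lognorm l q (s * t)"
    using z(1) by (auto simp: W_def st)
  have lt: "l * t \<le> 1" using zst assms by (simp add: field_simps)
  have t: "0 < t" using zst d by simp
  \<comment> \<open>For \<open>r = 0\<close> the left side is 0, while \<open>lognorm l p t\<close>
    is positive.\<close>
  have s: "0 < s"
  proof (rule ccontr)
    assume "\<not> 0 < s"
    then have "lognorm l p t \<le> 0" using zst by simp
    moreover have "lognorm l p 0 < lognorm l p t" using assms t lt by (intro lognorm_strict_mono) auto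
    ultimately show False by simp
  qed
  have less: "lognorm l q (r * u) < lognorm l p u" if "0 \<le> r" "r < s" "d \<le> u" "l * u \<le> 1" for r u
  proof (rule ccontr)
    assume "\<not> ?thesis"
    then have "(r, u) \<in> W" using that zst assms by (auto simp: W_def field_simps)
    then show False using z(2)[of "(r, u)"] that by (simp add: st)
  qed
  have right: "lognorm l q (s * u) \<le> lognorm l p u" if u: "0 \<le> u" "l * u \<le> 1" for u
  \<comment> \<open>For \<open>u \<ge> d\<close>, minimality gives the strict inequality below
    \<open>s\<close> and \<open>r\<close> tends to \<open>s\<close>. For smaller \<open>u\<close>,
    \<open>s \<le> r1\<close> and the choice of \<open>d\<close> suffice.\<close>
  proof (cases "d \<le> u")
    case True
    have "continuous_on UNIV (\<lambda>r. lognorm l p u - lognorm l q (r * u))"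
      using assms by (intro continuous_intros continuous_on_compose2[OF continuous_on_lognorm[of l q UNIV]]) auto
    then have "continuous_on (closure {0<..<s}) (\<lambda>r. lognorm l p u - lognorm l q (r * u))"
      by (rule continuous_on_subset) simp
    then have "0 \<le> lognorm l p u - lognorm l q (s * u)"
    proof (rule continuous_ge_on_closure)
      show "s \<in> closure {0<..<s}" using s by simp
      show "0 \<le> lognorm l p u - lognorm l q (r * u)" if "r \<in> {0<..<s}" for r
        using less[of r u] that True u by simp
    qed
    then show ?thesis by simp
  next
    case False
    show ?thesis
    proof (cases "u = 0")
      case False
      have "lognorm l q (s * u) \<le> lognorm l q (r1 * u)"
        using assms zst r1 R u by (intro mono) auto
      also have "\<dots> < lognorm l p u" using \<open>\<not> d \<le> u\<close> u False by (intro d) auto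
      finally show ?thesis by simp
    qed simp
  qed
  \<comment> \<open>Negative parameters obey the symmetric bound with \<open>R\<close>, and
    \<open>s \<le> r1 < R\<close>.\<close>
  have left: "lognorm (1 - l) q (s * u) \<le> lognorm (1 - l) p u" if u: "0 \<le> u" "(1 - l) * u \<le> 1" for u
  proof -
    have "lognorm (1 - l) q (s * u) \<le> lognorm (1 - l) q (R * u)"
      using assms zst r1 R u by (intro mono) auto
    also have "\<dots> \<le> lognorm (1 - l) p u"
      unfolding R_def using assms u by (intro lognorm_contraction_large_atom) auto
    finally show ?thesis .
  qed
  have s1: "s < 1" using zst r1 R by simp
  have contr: "lognorm l q (s * u) \<le> lognorm l p u" for u
  proof (rule lognorm_contraction_of_nonneg[OF _ _ _ _ _ _ right left])
  qed (use assms s s1 in simp_all)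
  then have "lognorm l q (s * t) = lognorm l p t" using zst(5) by (intro antisym)
  then show ?thesis by (rule that[OF s s1 t lt contr])
qed

section \<open>Ratio coordinates and the critical-point system\<close>

text \<open>
  The function \<open>1 + t X\<close> takes two values; \<open>t = slope l x\<close> is the parameter for which their ratio
  (value on the large atom over value on the small atom) is \<open>x\<close>. This is the change of variables
  behind the unknowns \<open>x\<close> and \<open>y\<close> of the system.
\<close>
definition slope :: "real \<Rightarrow> real \<Rightarrow> real" where
  "slope l x = (1 - x) / (l + (1 - l) * x)"

text \<open>The values \<open>1\<close> and \<open>x\<close> with masses \<open>l\<close> and
  \<open>1 - l\<close>, divided by their mean, are the values of \<open>1 + t * X\<close> at this
  \<open>t\<close>.\<close>

lemma slope_endpoints:
  assumes "0 < l" "l < 1" "0 \<le> x"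
  shows "1 + (1 - l) * slope l x = 1 / (l + (1 - l) * x)"
    and "1 - l * slope l x = x / (l + (1 - l) * x)"
proof -
  have "0 < l + (1 - l) * x" using assms by (simp add: add_pos_nonneg)
  then show "1 + (1 - l) * slope l x = 1 / (l + (1 - l) * x)"
    and "1 - l * slope l x = x / (l + (1 - l) * x)"
    by (simp_all add: slope_def field_simps)
qed

lemma slope_inverse:
  assumes "0 < l" "l < 1" "0 \<le> t"
  shows "slope l ((1 - l * t) / (1 + (1 - l) * t)) = t"
proof -
  have A: "0 < 1 + (1 - l) * t" using assms by (simp add: add_pos_nonneg)
  have "l + (1 - l) * ((1 - l * t) / (1 + (1 - l) * t)) = 1 / (1 + (1 - l) * t)"
    using A by (simp add: field_simps)
  moreover have "1 - (1 - l * t) / (1 + (1 - l) * t) = t / (1 + (1 - l) * t)"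
    using A by (simp add: field_simps)
  ultimately show ?thesis using A by (simp add: slope_def)
qed

lemma mom_slope:
  assumes "0 < l" "l < 1" "0 \<le> x"
  shows "mom l p (slope l x) = (l + (1 - l) * x powr p) / (l + (1 - l) * x) powr p"
proof -
  have "0 < l + (1 - l) * x" using assms by (simp add: add_pos_nonneg)
  then show ?thesis
    using assms by (simp add: mom_def slope_endpoints powr_divide add_divide_distrib)
qed

text \<open>This norm is one side of the first equation of the system.\<close>

lemma exp_lognorm_slope:
  assumes "0 < l" "l < 1" "0 \<le> x" "0 < p"
  shows "exp (lognorm l p (slope l x)) = (l + (1 - l) * x powr p) powr (1 / p) / (l + (1 - l) * x)"
proof -
  have pos: "0 < l + (1 - l) * x" "0 < l + (1 - l) * x powr p" using assms by (simp_all add: add_pos_nonneg)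
  have "exp (lognorm l p (slope l x)) = mom l p (slope l x) powr (1 / p)"
    using mom_pos[OF assms(1,2), of p "slope l x"] by (simp add: lognorm_def powr_def)
  also have "\<dots> = (l + (1 - l) * x powr p) powr (1 / p) / (l + (1 - l) * x)"
    using pos assms by (simp add: mom_slope powr_divide powr_powr)
  finally show ?thesis .
qed

text \<open>The scale-invariant derivative, \<open>t\<close> times the derivative in
  \<open>t\<close>, gives one side of the second equation up to the common factor
  \<open>l * (1 - l)\<close>; invariance removes \<open>s\<close> from the critical-point
  condition.\<close>

lemma lognorm_derivative_slope:
  assumes "0 < l" "l < 1" "0 \<le> x" "1 < p"
  defines "t \<equiv> slope l x"
  shows "t * (l * (1 - l) * ((1 + (1 - l) * t) powr (p - 1) - (1 - l * t) powr (p - 1)) / mom l p t)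
    = l * (1 - l) * ((1 - x) * (1 - x powr (p - 1)) / (l + (1 - l) * x powr p))"
proof -
  define c where "c = l + (1 - l) * x"
  define N where "N = l + (1 - l) * x powr p"
  have c: "0 < c" using assms by (simp add: c_def add_pos_nonneg)
  have N: "0 < N" using assms by (simp add: N_def add_pos_nonneg)
  have m: "mom l p t = N / c powr p" unfolding t_def c_def N_def by (rule mom_slope[OF assms(1-3)])
  have A: "1 + (1 - l) * t = 1 / c" and B: "1 - l * t = x / c"
    unfolding t_def c_def by (rule slope_endpoints[OF assms(1-3)])+
  have "(1 / c) powr (p - 1) - (x / c) powr (p - 1) = (1 - x powr (p - 1)) * c / c powr p"
    using c assms by (simp add: powr_divide powr_diff field_simps)
  then show ?thesis
    unfolding m A B N_def[symmetric] using c N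
    by (simp add: t_def slope_def c_def[symmetric])
qed

text \<open>The variables \<open>x\<close> and \<open>y\<close> are the ratios belonging to the
  contact parameter \<open>t\<close> and to \<open>s * t\<close>. Contact and criticality there are
  the two equations.\<close>

lemma extremal_system:
  assumes "0 < l" "l < 1 / 2" "1 < p" "p < q"
  obtains s x y where "0 < s" "s < 1" "0 < x" "x < 1" "0 < y" "y < 1"
    "\<And>u. lognorm l q (s * u) \<le> lognorm l p u"
    "lognorm l q (slope l y) = lognorm l p (slope l x)"
    "s * slope l x = slope l y"
    "(1 - x) * (1 - x powr (p - 1)) / (l + (1 - l) * x powr p)
      = (1 - y) * (1 - y powr (q - 1)) / (l + (1 - l) * y powr q)"
proof -
  have l: "l < 1" using assms by simp
  obtain s t where s: "0 < s" "s < 1" and t: "0 < t" "l * t \<le> 1"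
    and contr: "\<And>u. lognorm l q (s * u) \<le> lognorm l p u" and eq: "lognorm l q (s * t) = lognorm l p t"
    using lognorm_extremal_exists[OF assms] by metis
  have st: "0 < s * t" "s * t < t" using s t by simp_all
  have "l * (s * t) < l * t" using st(2) assms(1) by simp
  then have lst: "l * (s * t) < 1" using t by linarith
  define x where "x = (1 - l * t) / (1 + (1 - l) * t)"
  define y where "y = (1 - l * (s * t)) / (1 + (1 - l) * (s * t))"
  have Px: "slope l x = t" unfolding x_def using assms t by (intro slope_inverse) auto
  have Py: "slope l y = s * t" unfolding y_def using assms st by (intro slope_inverse) auto
  have den: "0 < 1 + (1 - l) * t" "0 < 1 + (1 - l) * (s * t)"
    using t st l by (simp_all add: add_pos_pos)
  have x: "0 \<le> x" "x < 1" using t den by (simp_all add: x_def algebra_simps)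
  have y: "0 < y" "y < 1" using st lst den by (simp_all add: y_def algebra_simps)
  define Dp where "Dp = l * (1 - l) * ((1 + (1 - l) * t) powr (p - 1) - (1 - l * t) powr (p - 1)) / mom l p t"
  define Dq where "Dq = l * (1 - l) * ((1 + (1 - l) * (s * t)) powr (q - 1)
    - (1 - l * (s * t)) powr (q - 1)) / mom l q (s * t)"
  have dp: "(lognorm l p has_real_derivative Dp) (at t)"
    unfolding Dp_def using assms t by (intro lognorm_has_real_derivative) auto
  have "(lognorm l q has_real_derivative Dq) (at (s * t))"
    unfolding Dq_def using assms st lst by (intro lognorm_has_real_derivative) auto
  moreover have "((\<lambda>u. s * u) has_real_derivative s) (at t)"
    by (auto intro!: derivative_eq_intros)
  ultimately have "((\<lambda>u. lognorm l q (s * u)) has_real_derivative Dq * s) (at t)"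
    by (rule DERIV_chain2)
  then have "((\<lambda>u. lognorm l p u - lognorm l q (s * u)) has_real_derivative Dp - Dq * s) (at t)"
    by (intro DERIV_diff dp)
  \<comment> \<open>The inequality holds for all real parameters, so the contact point is a
    two-sided local minimum even when \<open>l * t = 1\<close>.\<close>
  then have "Dp - Dq * s = 0"
    by (rule DERIV_local_min[OF _ zero_less_one]) (use contr eq in auto)
  then have "t * Dp = (s * t) * Dq" by (simp add: algebra_simps)
  moreover have "t * Dp = l * (1 - l) * ((1 - x) * (1 - x powr (p - 1)) / (l + (1 - l) * x powr p))"
    using lognorm_derivative_slope[of l x p] assms x by (simp add: Px Dp_def)
  moreover have "(s * t) * Dq = l * (1 - l) * ((1 - y) * (1 - y powr (q - 1)) / (l + (1 - l) * y powr q))"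
    using lognorm_derivative_slope[of l y q] assms y by (simp add: Py Dq_def)
  ultimately have "l * (1 - l) * ((1 - x) * (1 - x powr (p - 1)) / (l + (1 - l) * x powr p))
      = l * (1 - l) * ((1 - y) * (1 - y powr (q - 1)) / (l + (1 - l) * y powr q))"
    by (simp only:)
  then have crit: "(1 - x) * (1 - x powr (p - 1)) / (l + (1 - l) * x powr p)
      = (1 - y) * (1 - y powr (q - 1)) / (l + (1 - l) * y powr q)"
    using assms(1) l by (subst (asm) mult_left_cancel) simp_all
  \<comment> \<open>The boundary case \<open>l * t = 1\<close> is \<open>x = 0\<close>; the critical
    equation would then equate \<open>1 / l\<close> with something strictly smaller.\<close>
  have "x \<noteq> 0"
  proof
    assume "x = 0"
    then have "1 / l = (1 - y) * (1 - y powr (q - 1)) / (l + (1 - l) * y powr q)"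
      using crit by simp
    moreover have "\<dots> < 1 / l"
    proof -
      have y1: "0 < y powr (q - 1)" "y powr (q - 1) < 1" "0 < y powr q"
        using y assms by (auto intro: powr_lt_one)
      have "(1 - y) * (1 - y powr (q - 1)) < 1 * 1"
        using y y1 by (intro mult_strict_mono) auto
      moreover have "l < l + (1 - l) * y powr q" using y1 l by simp
      ultimately show ?thesis using assms y y1 by (intro frac_less2) auto
    qed
    ultimately show False by simp
  qed
  then have "0 < x" using x by simp
  show ?thesis
    by (rule that[OF s \<open>0 < x\<close> x(2) y contr _ _ crit]) (simp_all only: Px Py eq)
qed

subsection \<open>Conjugate exponents\<close>

lemma mom_two:
  assumes "0 < l" "l < 1"
  shows "mom l 2 t = 1 + l * (1 - l) * t\<^sup>2"
  unfolding mom_def by (simp add: algebra_simps power2_eq_square powr_numeral)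

text \<open>The left side is the expectation of \<open>(1 + t * X) * (1 + u * X)\<close>. Young's
  inequality is applied on each atom after normalising by the norms \<open>F\<close> and
  \<open>G\<close>.\<close>

lemma two_point_Hoelder:
  assumes "0 < l" "l < 1" "1 < p" "1 < q" "1 / p + 1 / q = 1"
  shows "1 + l * (1 - l) * (t * u) \<le> exp (lognorm l p t) * exp (lognorm l q u)"
proof -
  define F G where "F = exp (lognorm l p t)" and "G = exp (lognorm l q u)"
  have pos: "0 < F" "0 < G" by (simp_all add: F_def G_def)
  have Fp: "F powr p = mom l p t" and Gq: "G powr q = mom l q u"
    using mom_pos[OF assms(1,2)] assms
    by (simp_all add: F_def G_def powr_def lognorm_def)
  define a b where "a = 1 + (1 - l) * t" and "b = 1 - l * t"
  define c d where "c = 1 + (1 - l) * u" and "d = 1 - l * u"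
  have Y: "x * y \<le> F * G * ((\<bar>x\<bar> powr p / mom l p t) / p + (\<bar>y\<bar> powr q / mom l q u) / q)" for x y
  proof -
    have "(\<bar>x\<bar> / F) * (\<bar>y\<bar> / G) \<le> (\<bar>x\<bar> / F) powr p / p + (\<bar>y\<bar> / G) powr q / q"
      using assms pos by (intro Youngs_inequality) auto
    also have "\<dots> = (\<bar>x\<bar> powr p / mom l p t) / p + (\<bar>y\<bar> powr q / mom l q u) / q"
      using pos by (simp add: powr_divide Fp Gq)
    finally have "F * G * ((\<bar>x\<bar> / F) * (\<bar>y\<bar> / G))
        \<le> F * G * ((\<bar>x\<bar> powr p / mom l p t) / p + (\<bar>y\<bar> powr q / mom l q u) / q)"
      using pos by (intro mult_left_mono) auto
    moreover have "F * G * ((\<bar>x\<bar> / F) * (\<bar>y\<bar> / G)) = \<bar>x * y\<bar>"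
      using pos by (simp add: abs_mult)
    ultimately show ?thesis by linarith
  qed
  have "1 + l * (1 - l) * (t * u) = l * (a * c) + (1 - l) * (b * d)"
    by (simp add: a_def b_def c_def d_def algebra_simps)
  also have "\<dots> \<le> l * (F * G * ((\<bar>a\<bar> powr p / mom l p t) / p + (\<bar>c\<bar> powr q / mom l q u) / q))
      + (1 - l) * (F * G * ((\<bar>b\<bar> powr p / mom l p t) / p + (\<bar>d\<bar> powr q / mom l q u) / q))"
    using assms by (intro add_mono mult_left_mono Y) auto
  also have "\<dots> = F * G * ((l * \<bar>a\<bar> powr p + (1 - l) * \<bar>b\<bar> powr p) / mom l p t / p
      + (l * \<bar>c\<bar> powr q + (1 - l) * \<bar>d\<bar> powr q) / mom l q u / q)"
    by (simp add: algebra_simps add_divide_distrib diff_divide_distrib)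
  also have "\<dots> = F * G * (mom l p t / mom l p t / p + mom l q u / mom l q u / q)"
    by (simp add: mom_def a_def b_def c_def d_def)
  also have "\<dots> = F * G"
    using mom_pos[OF assms(1,2), of p t] mom_pos[OF assms(1,2), of q u] assms by simp
  finally show ?thesis by (simp add: F_def G_def)
qed

text \<open>The squared \<open>L^2\<close> norm at \<open>s * t\<close> is the pairing of the
  functions at \<open>t\<close> and \<open>s\<^sup>2 * t\<close>, hence at most the product of their
  \<open>L^p\<close> and \<open>L^q\<close> norms. The \<open>L^q\<close> factor is itself at most
  the \<open>L^2\<close> norm at \<open>s * t\<close>.\<close>

lemma lognorm_contraction_conjugate:
  assumes "0 < l" "l < 1" "1 < p" "1 < q" "1 / p + 1 / q = 1"
    and contr: "\<And>u. lognorm l q (s * u) \<le> lognorm l 2 u"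
  shows "lognorm l q (s\<^sup>2 * t) \<le> lognorm l p t"
proof -
  have "mom l 2 (s * t) = 1 + l * (1 - l) * (t * (s\<^sup>2 * t))"
    using assms by (simp add: mom_two power_mult_distrib power2_eq_square)
  also have "\<dots> \<le> exp (lognorm l p t) * exp (lognorm l q (s\<^sup>2 * t))"
    using assms by (intro two_point_Hoelder)
  finally have "mom l 2 (s * t) \<le> exp (lognorm l p t + lognorm l q (s\<^sup>2 * t))"
    by (simp add: exp_add)
  then have "ln (mom l 2 (s * t)) \<le> lognorm l p t + lognorm l q (s\<^sup>2 * t)"
    using mom_pos[OF assms(1,2), of 2 "s * t"] by (simp add: ln_le_cancel_iff[symmetric] del: ln_le_cancel_iff)
  moreover have "ln (mom l 2 (s * t)) = 2 * lognorm l 2 (s * t)" by (simp add: lognorm_def)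
  moreover have "lognorm l q (s\<^sup>2 * t) \<le> lognorm l 2 (s * t)"
    using contr[of "s * t"] by (simp add: power2_eq_square mult.assoc)
  ultimately show ?thesis by simp
qed

text \<open>The function \<open>h\<close> vanishes at 0 and at \<open>sqrt N\<close> and is odd
  under \<open>z \<mapsto> N / z\<close>. A further positive zero would come with its reflection;
  four zeros give three critical points, yet the numerator of \<open>h'\<close> is quadratic and not
  identically zero.\<close>

lemma conjugate_critical_unique:
  fixes k y q :: real
  assumes "0 < k" "0 < y" "y < 1" "2 < q"
    and eq: "(1 - 2 / q) * ln (k + y powr q) + ln (k + y)
      = ln (k + y powr (q - 1)) + (1 - 2 / q) * ln (1 + k)"
  shows "k\<^sup>2 = y powr q"
proof (rule ccontr)
  assume neq: "k\<^sup>2 \<noteq> y powr q"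
  define c where "c = 1 - 2 / q"
  define N where "N = y powr q"
  define Y where "Y = y powr (q - 1)"
  have c: "c * q = q - 2" "0 < c" using assms by (simp_all add: c_def field_simps)
  have pos: "0 < N" "0 < Y" "Y < 1" "Y < y" using assms powr_less_mono'[of y 1 "q - 1"]
    by (auto simp: N_def Y_def intro: powr_lt_one)
  have N: "N = y * Y" using assms by (simp add: N_def Y_def powr_diff)
  have ln: "ln N = q * ln y" "ln Y = (q - 1) * ln y"
    using assms by (simp_all add: N_def Y_def ln_powr)
  define h where "h z = c * ln (z + N) + ln (z + y) - ln (z + Y) - c * ln (1 + z)" for z
  define A where "A = c * (1 - N) - (y - Y)"
  define B where "B = c * (1 - N) * (y + Y) - (y - Y) * (1 + N)"
  define h' where "h' z = (A * z\<^sup>2 + B * z + A * N) / ((z + N) * (1 + z) * (z + y) * (z + Y))" for z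
  have dh: "(h has_real_derivative h' z) (at z)" if "0 \<le> z" for z
  proof -
    have z: "0 < z + N" "0 < 1 + z" "0 < z + y" "0 < z + Y" using that assms pos by simp_all
    have "(h has_real_derivative c / (z + N) + 1 / (z + y) - 1 / (z + Y) - c / (1 + z)) (at z)"
      unfolding h_def[abs_def] using z by (auto intro!: derivative_eq_intros)
    also have "c / (z + N) + 1 / (z + y) - 1 / (z + Y) - c / (1 + z)
      = c * (1 - N) / ((z + N) * (1 + z)) - (y - Y) / ((z + y) * (z + Y))"
      using z by (simp add: diff_frac_eq add_frac_eq) (simp add: field_simps)
    also have "\<dots> = (c * (1 - N) * ((z + y) * (z + Y)) - (y - Y) * ((z + N) * (1 + z)))
        / ((z + N) * (1 + z) * ((z + y) * (z + Y)))"
      using z by (simp add: diff_frac_eq)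
    also have "c * (1 - N) * ((z + y) * (z + Y)) - (y - Y) * ((z + N) * (1 + z)) = A * z\<^sup>2 + B * z + A * N"
      unfolding A_def B_def N by (simp add: algebra_simps power2_eq_square)
    finally show ?thesis by (simp add: h'_def mult.assoc)
  qed
  have "h 0 = (c * q - (q - 2)) * ln y" by (simp add: h_def ln algebra_simps)
  then have h0: "h 0 = 0" by (simp add: c)
  \<comment> \<open>The factorisation \<open>N = y * Y\<close> exchanges the arguments of the
    logarithms in pairs; the leftover multiple of \<open>ln y\<close> vanishes by the choice of
    \<open>c\<close>.\<close>
  have reflect: "h (N / z) = - h z" if z: "0 < z" for z
  proof -
    have e: "N / z + N = N * (1 + z) / z" "1 + N / z = (z + N) / z"
      "N / z + y = y * (z + Y) / z" "N / z + Y = Y * (z + y) / z"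
      using z by (simp_all add: field_simps N)
    have "h (N / z) = c * (ln N + ln (1 + z) - ln z) + (ln y + ln (z + Y) - ln z)
      - (ln Y + ln (z + y) - ln z) - c * (ln (z + N) - ln z)"
      unfolding h_def e using z assms pos by (simp add: ln_div ln_mult)
    also have "\<dots> = - h z + (c * q - (q - 2)) * ln y"
      by (simp add: h_def ln algebra_simps)
    finally show ?thesis by (simp add: c)
  qed
  define m where "m = sqrt N"
  have m: "0 < m" "m * m = N" using pos by (simp_all add: m_def)
  have "N / m = m" using m by (simp add: field_simps)
  then have hm: "h m = 0" using reflect[OF m(1)] by simp
  have hk: "h k = 0" using eq by (simp add: h_def c_def N_def Y_def)
  have "k \<noteq> m" using neq m by (auto simp: N_def power2_eq_square)
  \<comment> \<open>Replacing \<open>k\<close> by \<open>N / k\<close> if needed places the extra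
    zero below \<open>m\<close>.\<close>
  then obtain a where a: "0 < a" "a < m" "h a = 0"
  proof (cases "k < m")
    case False
    then have "m < k" using \<open>k \<noteq> m\<close> by simp
    then have "N < m * k" using m by (metis mult_strict_left_mono)
    then have "N / k < m" using assms by (simp add: field_simps)
    then show ?thesis using that[of "N / k"] reflect[of k] hk assms pos by simp
  qed (use that assms hk in blast)
  define b where "b = N / a"
  have "m * a < N" using a m by (metis mult_strict_left_mono)
  then have b: "m < b" "h b = 0" using a reflect[of a] by (simp_all add: b_def field_simps)
  have zero: "\<exists>z. u < z \<and> z < v \<and> A * z\<^sup>2 + B * z + A * N = 0"
    if "0 \<le> u" "u < v" "h u = 0" "h v = 0" for u v
  proof -
    have "\<exists>z>u. z < v \<and> h v - h u = (v - u) * h' z"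
      by (rule MVT2[OF that(2)]) (use dh that(1) in auto)
    then obtain z where z: "u < z" "z < v" "h v - h u = (v - u) * h' z" by blast
    then have "h' z = 0" using that by simp
    moreover have "(z + N) * (1 + z) * (z + y) * (z + Y) \<noteq> 0" using z that assms pos by simp
    ultimately show ?thesis using z unfolding h'_def by auto
  qed
  obtain z1 where z1: "0 < z1" "z1 < a" "A * z1\<^sup>2 + B * z1 + A * N = 0"
    using zero[of 0 a] h0 a by auto
  obtain z2 where z2: "a < z2" "z2 < m" "A * z2\<^sup>2 + B * z2 + A * N = 0"
    using zero[of a m] hm a by auto
  obtain z3 where z3: "m < z3" "z3 < b" "A * z3\<^sup>2 + B * z3 + A * N = 0"
    using zero[of m b] hm b m by auto
  \<comment> \<open>Three distinct roots force all coefficients of the quadratic to vanish.\<close>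
  have "(z2 - z1) * (A * (z1 + z2) + B) = 0" using z1 z2 by (simp add: algebra_simps power2_eq_square)
  then have e1: "A * (z1 + z2) + B = 0" using z1 z2 by simp
  have "(z3 - z2) * (A * (z2 + z3) + B) = 0" using z3 z2 by (simp add: algebra_simps power2_eq_square)
  then have e2: "A * (z2 + z3) + B = 0" using z3 z2 by simp
  have "A * (z3 - z1) = (A * (z2 + z3) + B) - (A * (z1 + z2) + B)" by (simp add: algebra_simps)
  then have "A * (z3 - z1) = 0" by (simp only: e1 e2)
  then have "A = 0" using z1 z2 z3 by simp
  moreover have "B = 0" using e1 \<open>A = 0\<close> by simp
  moreover have "B - A * (y + Y) = - ((y - Y) * ((1 - y) * (1 - Y)))"
    unfolding A_def B_def N by (simp add: algebra_simps)
  ultimately show False using pos assms by simp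
qed

text \<open>The squares \<open>X\<^sup>2\<close>, \<open>W\<^sup>2\<close> and the product
  \<open>X * W\<close> will be the two ratios and \<open>l / (1 - l)\<close>. The factor
  \<open>X + W\<close> cancels.\<close>

lemma sinh_quotient_eq:
  fixes a b :: real
  defines "X \<equiv> exp (- a)" and "W \<equiv> exp (- b)"
  assumes "a \<noteq> 0" "b \<noteq> 0"
  shows "(1 - X\<^sup>2) * (X * W + W\<^sup>2) / ((1 - W\<^sup>2) * (X * W + X\<^sup>2)) = sinh a / sinh b"
proof -
  have p: "0 < X" "0 < W" by (simp_all add: X_def W_def)
  have n: "X \<noteq> 1" "W \<noteq> 1" using assms by simp_all
  then have n2: "1 - X\<^sup>2 \<noteq> 0" "1 - W\<^sup>2 \<noteq> 0" using p by (auto simp: power2_eq_1_iff)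
  have s: "sinh a = (1 - X\<^sup>2) / (2 * X)" "sinh b = (1 - W\<^sup>2) / (2 * W)"
    using p by (simp_all add: sinh_def X_def W_def exp_minus field_simps power2_eq_square)
  have "X * W + W\<^sup>2 = W * (X + W)" "X * W + X\<^sup>2 = X * (X + W)"
    by (simp_all add: algebra_simps power2_eq_square)
  then show ?thesis using p n2 by (simp add: s)
qed

lemma slope_quotient:
  assumes "0 < l" "l < 1" "0 < x" "x < 1" "0 < y" "y < 1" "s * slope l x = slope l y"
  shows "s = ((1 - y) * (x + l / (1 - l))) / ((1 - x) * (y + l / (1 - l)))"
proof -
  define u v where "u = l + (1 - l) * x" and "v = l + (1 - l) * y"
  have uv: "0 < u" "0 < v" using assms by (simp_all add: u_def v_def add_pos_pos)
  have "x + l / (1 - l) = u / (1 - l)" "y + l / (1 - l) = v / (1 - l)"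
    using assms by (simp_all add: u_def v_def field_simps)
  moreover have "s = (1 - y) / v / ((1 - x) / u)"
  proof -
    have "s * ((1 - x) / u) = (1 - y) / v" using assms(7) by (simp add: slope_def u_def v_def)
    then show ?thesis using assms(4) uv by (subst nonzero_eq_divide_eq) auto
  qed
  ultimately show ?thesis using assms(2) uv by simp
qed

text \<open>The extremal pair is taken for exponents 2 and \<open>q\<close>. The square of its
  constant is admissible for \<open>p\<close> and \<open>q\<close>, and it is attained at the ratio
  \<open>Y = y powr (q - 1)\<close>.\<close>

lemma bernoulli_hc_const_conjugate:
  assumes "0 < l" "l < 1 / 2" "1 < p" "p < q" "q = p / (p - 1)"
  shows "bernoulli_hc_const p q l = sinh (1 / q * ln ((1 - l) / l)) / sinh (1 / p * ln ((1 - l) / l))"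
proof -
  have "1 / q = (p - 1) / p" using assms by simp
  then have conj: "1 / p + 1 / q = 1" using assms by (simp flip: add_divide_distrib)
  have q2: "2 < q"
  proof -
    have "1 / q < 1 / p" using assms by (intro divide_strict_left_mono) auto
    then have "2 / q < 1" using conj by simp
    moreover have "0 < q" using assms(3,4) by simp
    ultimately show ?thesis by simp
  qed
  have l: "l < 1" using assms by simp
  obtain s x y where s: "0 < s" "s < 1" and x: "0 < x" "x < 1" and y: "0 < y" "y < 1"
    and contr: "\<And>u. lognorm l q (s * u) \<le> lognorm l 2 u"
    and eq: "lognorm l q (slope l y) = lognorm l 2 (slope l x)"
    and sxy: "s * slope l x = slope l y"
    and crit: "(1 - x) * (1 - x powr (2 - 1)) / (l + (1 - l) * x powr 2)
      = (1 - y) * (1 - y powr (q - 1)) / (l + (1 - l) * y powr q)"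
    using extremal_system[OF assms(1,2) _ q2] by (metis one_less_numeral_iff semiring_norm(76))
  define v where "v = l * (1 - l)"
  define Y where "Y = y powr (q - 1)"
  define N where "N = l + (1 - l) * y powr q"
  define D where "D = l + (1 - l) * y"
  define E where "E = l + (1 - l) * Y"
  have v: "0 < v" using assms l by (simp add: v_def)
  have Y: "0 < Y" "Y < 1" using y q2 by (auto simp: Y_def intro: powr_lt_one)
  have yq: "y powr q = y * Y" using y by (simp add: Y_def powr_diff)
  have pos: "0 < N" "0 < D" "0 < E" using assms l y Y by (simp_all add: N_def D_def E_def add_pos_pos)
  have NDE: "N - v * ((1 - y) * (1 - Y)) = D * E"
    by (simp add: N_def D_def E_def v_def yq algebra_simps)
  define \<Phi> where "\<Phi> = mom l 2 (slope l x)"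
  have \<Phi>: "\<Phi> = 1 + v * (slope l x)\<^sup>2" using assms l by (simp add: \<Phi>_def mom_two v_def)
  have \<Phi>_pos: "0 < \<Phi>" unfolding \<Phi>_def using assms l by (intro mom_pos) auto
  have "(slope l x)\<^sup>2 / \<Phi> = (1 - y) * (1 - Y) / N"
  proof -
    have "0 < l + (1 - l) * x" using assms l x by (simp add: add_pos_pos)
    moreover have "\<Phi> = (l + (1 - l) * x powr 2) / (l + (1 - l) * x) powr 2"
      unfolding \<Phi>_def using x assms(1) l by (intro mom_slope) auto
    ultimately have "(slope l x)\<^sup>2 / \<Phi> = (1 - x)\<^sup>2 / (l + (1 - l) * x powr 2)"
      by (simp add: slope_def power_divide)
    also have "\<dots> = (1 - x) * (1 - x powr (2 - 1)) / (l + (1 - l) * x powr 2)"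
      using x by (simp add: power2_eq_square)
    finally show ?thesis using crit by (simp add: Y_def N_def)
  qed
  then have sl: "(slope l x)\<^sup>2 = \<Phi> * ((1 - y) * (1 - Y) / N)"
    using \<Phi>_pos by (simp add: field_simps)
  \<comment> \<open>For exponent 2, \<open>x\<close> enters only through the square of its slope.
    Criticality makes this square a multiple of \<open>\<Phi>\<close>, so \<open>\<Phi>\<close>
    solves a linear equation in terms of \<open>y\<close> alone.\<close>
  have "\<Phi> * (N - v * ((1 - y) * (1 - Y))) = N"
    using \<Phi> pos unfolding sl by (simp add: field_simps)
  then have \<Phi>_eq: "\<Phi> = N / (D * E)" unfolding NDE using pos by (simp add: field_simps)
  have "ln \<Phi> = 2 * lognorm l q (slope l y)" unfolding eq by (simp add: \<Phi>_def lognorm_def)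
  also have "lognorm l q (slope l y) = ln N / q - ln D"
  proof -
    have "mom l q (slope l y) = N / D powr q" using assms l y by (simp add: mom_slope N_def D_def)
    then have "ln (mom l q (slope l y)) = ln N - q * ln D"
      using pos by (simp only: ln_div powr_gt_zero) (simp add: ln_powr ln_div)
    then show ?thesis using q2 by (simp add: lognorm_def diff_divide_distrib)
  qed
  finally have main: "(1 - 2 / q) * ln N = ln E - ln D"
    using pos by (simp add: \<Phi>_eq ln_div ln_mult field_simps)
  \<comment> \<open>After elimination the squared slope of \<open>x\<close> is
    \<open>(1 - y) * (1 - Y) / (D * E)\<close>, and one factor \<open>(1 - y) / D\<close>
    cancels.\<close>
  have s2: "s\<^sup>2 * slope l Y = slope l y"
  proof -
    have "s\<^sup>2 * (slope l x)\<^sup>2 = (slope l y)\<^sup>2" using sxy by (simp flip: power_mult_distrib)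
    then have "s\<^sup>2 * ((1 - y) * (1 - Y) / (D * E)) = (1 - y)\<^sup>2 / D\<^sup>2"
      unfolding sl \<Phi>_eq using pos by (simp add: slope_def D_def[symmetric] power_divide)
    then have "((1 - y) / D) * (s\<^sup>2 * ((1 - Y) / E)) = ((1 - y) / D) * ((1 - y) / D)"
      by (simp add: power2_eq_square mult_ac)
    then have "s\<^sup>2 * ((1 - Y) / E) = (1 - y) / D"
      using pos y by (subst (asm) mult_left_cancel) auto
    then show ?thesis by (simp add: slope_def D_def E_def)
  qed
  have "bernoulli_hc_const p q l = s\<^sup>2"
  proof (rule bernoulli_hc_const_eqI[where t = "slope l Y"])
    show "s\<^sup>2 < 1" using s by (simp add: power_less_one_iff)
    show "lognorm l q (s\<^sup>2 * t) \<le> lognorm l p t" for t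
      using assms l q2 conj contr by (intro lognorm_contraction_conjugate) auto
    show "0 < slope l Y" using Y pos by (simp add: slope_def E_def)
    have "0 \<le> Y / E" using Y pos by simp
    then show "l * slope l Y \<le> 1"
      using slope_endpoints(2)[OF assms(1) l, of Y] Y unfolding E_def by linarith
    \<comment> \<open>This is the equality condition in Hoelder's inequality and explains the choice
      of \<open>Y\<close>.\<close>
    have "Y powr p = y powr q"
    proof -
      have "(q - 1) * p = q" using assms by (simp add: field_simps)
      then show ?thesis by (simp add: Y_def powr_powr)
    qed
    then have "mom l p (slope l Y) = N / E powr p" using assms l Y by (simp add: mom_slope N_def E_def)
    then have "ln (mom l p (slope l Y)) = ln N - p * ln E"
      using pos by (simp only: ln_div powr_gt_zero) (simp add: ln_powr ln_div)
    then have "lognorm l p (slope l Y) = ln N / p - ln E"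
      using assms(3) by (simp add: lognorm_def diff_divide_distrib)
    moreover have "1 / p = 1 - 1 / q" using conj by simp
    then have "ln N / p = ln N - ln N / q" by (metis left_diff_distrib mult.commute mult_1 times_divide_eq_right)
    moreover have "ln N - 2 * (ln N / q) = ln E - ln D" using main by (simp add: left_diff_distrib)
    ultimately show "lognorm l q (s\<^sup>2 * slope l Y) = lognorm l p (slope l Y)"
      using \<open>lognorm l q (slope l y) = ln N / q - ln D\<close> unfolding s2 by linarith
  qed (use assms l in auto)
  moreover have "s\<^sup>2 = sinh (1 / q * ln ((1 - l) / l)) / sinh (1 / p * ln ((1 - l) / l))"
  proof -
    define k where "k = l / (1 - l)"
    have k: "0 < k" using assms l by (simp add: k_def)
    have k1: "1 + k = 1 / (1 - l)" using l by (simp add: k_def field_simps)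
    have e: "N = (k + y powr q) / (1 + k)" "D = (k + y) / (1 + k)" "E = (k + Y) / (1 + k)"
      using l unfolding k1 by (simp_all add: N_def D_def E_def k_def field_simps)
    have "(1 - 2 / q) * ln (k + y powr q) + ln (k + y)
      = ln (k + y powr (q - 1)) + (1 - 2 / q) * ln (1 + k)"
    proof -
      have "0 < k + y powr q" "0 < k + y" "0 < k + Y" "0 < 1 + k" using k y Y by (simp_all add: add_pos_nonneg)
      then have "ln N = ln (k + y powr q) - ln (1 + k)" "ln D = ln (k + y) - ln (1 + k)"
        "ln E = ln (k + Y) - ln (1 + k)"
        unfolding e by (auto simp only: ln_div split: if_splits)
      then show ?thesis using main by (simp add: Y_def right_diff_distrib)
    qed
    then have kq: "k\<^sup>2 = y powr q"
      using k y q2 by (intro conjugate_critical_unique) auto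
    define L where "L = ln ((1 - l) / l)"
    have L: "0 < L" using assms by (simp add: L_def)
    have lk: "ln k = - L" using assms l by (simp add: k_def L_def ln_div)
    \<comment> \<open>With \<open>k = exp (- L)\<close>, the relation
      \<open>k\<^sup>2 = y powr q\<close> determines \<open>y\<close> and \<open>Y\<close>; their
      square roots are \<open>X\<close> and \<open>W\<close>, and \<open>k = X * W\<close> because
      the exponents are conjugate.\<close>
    define X W where "X = exp (- (1 / q * L))" and "W = exp (- (1 / p * L))"
    have lny: "ln y = - 2 / q * L"
    proof -
      have "2 * ln k = q * ln y" using arg_cong[OF kq, of ln] k y by (simp add: ln_realpow ln_powr)
      then show ?thesis using lk q2 by (simp add: field_simps)
    qed
    have "y = exp (ln y)" using y by simp
    also have "\<dots> = X\<^sup>2" unfolding lny X_def by (simp flip: exp_of_nat_mult)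
    finally have yX: "y = X\<^sup>2" .
    have "ln Y = (q - 1) * (- 2 / q * L)" by (simp add: Y_def ln_powr lny y)
    also have "\<dots> = - (2 * (1 - 1 / q)) * L" using q2 by (simp add: field_simps)
    also have "1 - 1 / q = 1 / p" using conj by simp
    finally have "ln Y = - 2 / p * L" by simp
    then have "Y = exp (- 2 / p * L)" using Y by (metis exp_ln)
    then have YW: "Y = W\<^sup>2" unfolding W_def by (simp flip: exp_of_nat_mult)
    have "k = exp (- ((1 / p + 1 / q) * L))" using k lk by (simp add: conj) (metis exp_ln)
    also have "\<dots> = X * W" by (simp add: X_def W_def algebra_simps flip: exp_add)
    finally have kXW: "k = X * W" .
    have "s\<^sup>2 = ((1 - y) * (Y + k)) / ((1 - Y) * (y + k))"
      unfolding k_def using slope_quotient[OF assms(1) l Y y s2] .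
    also have "\<dots> = (1 - X\<^sup>2) * (X * W + W\<^sup>2) / ((1 - W\<^sup>2) * (X * W + X\<^sup>2))"
      unfolding yX YW kXW by (simp add: add.commute)
    also have "\<dots> = sinh (1 / q * L) / sinh (1 / p * L)"
      unfolding X_def W_def using L assms by (intro sinh_quotient_eq) auto
    finally show ?thesis by (simp add: L_def)
  qed
  ultimately show ?thesis by simp
qed

section \<open>The solution of the system and the value of the constant\<close>

theorem theorem1p6:
  fixes lam p q :: real
  assumes "0 < lam" and "lam < 1 / 2" and "1 < p" and "p < q"
  shows "(\<exists>x\<in>{0<..<1}. \<exists>y\<in>{0<..<1}.
            (lam + (1 - lam) * x powr p) powr (1 / p) / (lam + (1 - lam) * x) =
              (lam + (1 - lam) * y powr q) powr (1 / q) / (lam + (1 - lam) * y) \<and>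
            (1 - x) * (1 - x powr (p - 1)) / (lam + (1 - lam) * x powr p) =
              (1 - y) * (1 - y powr (q - 1)) / (lam + (1 - lam) * y powr q) \<and>
            bernoulli_hc_const p q lam =
              ((1 - y) * (x + lam / (1 - lam))) / ((1 - x) * (y + lam / (1 - lam))))
       \<and> (q = p / (p - 1) \<longrightarrow>
            bernoulli_hc_const p q lam =
              sinh (1 / q * ln ((1 - lam) / lam)) / sinh (1 / p * ln ((1 - lam) / lam)))"
proof (rule conjI)
  have l: "lam < 1" using assms by simp
  obtain s x y where s: "0 < s" "s < 1" and x: "0 < x" "x < 1" and y: "0 < y" "y < 1"
    and contr: "\<And>u. lognorm lam q (s * u) \<le> lognorm lam p u"
    and eq: "lognorm lam q (slope lam y) = lognorm lam p (slope lam x)"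
    and sxy: "s * slope lam x = slope lam y"
    and crit: "(1 - x) * (1 - x powr (p - 1)) / (lam + (1 - lam) * x powr p)
      = (1 - y) * (1 - y powr (q - 1)) / (lam + (1 - lam) * y powr q)"
    using extremal_system[OF assms] by metis
  have "0 < lam + (1 - lam) * x" using assms x by (simp add: add_pos_pos)
  then have "0 < slope lam x" "0 \<le> x / (lam + (1 - lam) * x)" using x by (simp_all add: slope_def)
  then have "lam * slope lam x \<le> 1"
    using slope_endpoints(2)[of lam x] assms(1) l x by linarith
  \<comment> \<open>The first equation says that equality holds at the parameter
    \<open>slope lam x\<close>, which certifies that \<open>s\<close> is optimal.\<close>
  then have "bernoulli_hc_const p q lam = s"
    using assms l s contr eq \<open>0 < slope lam x\<close>
    by (intro bernoulli_hc_const_eqI[where t = "slope lam x"]) (auto simp: sxy)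
  also have "s = ((1 - y) * (x + lam / (1 - lam))) / ((1 - x) * (y + lam / (1 - lam)))"
    using assms l x y sxy by (intro slope_quotient) auto
  finally have const: "bernoulli_hc_const p q lam = \<dots>" .
  have "(lam + (1 - lam) * x powr p) powr (1 / p) / (lam + (1 - lam) * x) =
      (lam + (1 - lam) * y powr q) powr (1 / q) / (lam + (1 - lam) * y)"
    using exp_lognorm_slope[of lam x p] exp_lognorm_slope[of lam y q] assms l x y eq by simp
  then show "\<exists>x\<in>{0<..<1}. \<exists>y\<in>{0<..<1}.
      (lam + (1 - lam) * x powr p) powr (1 / p) / (lam + (1 - lam) * x) =
        (lam + (1 - lam) * y powr q) powr (1 / q) / (lam + (1 - lam) * y) \<and>
      (1 - x) * (1 - x powr (p - 1)) / (lam + (1 - lam) * x powr p) =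
        (1 - y) * (1 - y powr (q - 1)) / (lam + (1 - lam) * y powr q) \<and>
      bernoulli_hc_const p q lam =
        ((1 - y) * (x + lam / (1 - lam))) / ((1 - x) * (y + lam / (1 - lam)))"
    using x y crit const by (intro bexI[of _ x] bexI[of _ y] conjI) auto
  show "q = p / (p - 1) \<longrightarrow> bernoulli_hc_const p q lam =
      sinh (1 / q * ln ((1 - lam) / lam)) / sinh (1 / p * ln ((1 - lam) / lam))"
    using bernoulli_hc_const_conjugate[OF assms] by blast
qed

end
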